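(* Let $p$ be a prime, let $M\in\mathbb{N}$, and let $k$ be an integer with $2\le k\le M(p-1)+1$. Then the system $\Phi_{k,M}$ has true complexity exactly $k-2$. Moreover, there is a constant $c=c_{k,M,p}\in(0,1]$ such that for every $n\in\mathbb{N}$ and every collection of $1$-bounded functions $(f_z:\mathbb{F}_p^n\to\mathbb{C})_{z\in S_{k,M}}$ we have \[ \big|\Lambda_{\Phi_{k,M}}\big((f_z)_{z\in S_{k,M}}\big)\big|\le \min_{z\in S_{k,M}}\|f_z\|_{U^{k-1}}^{c}. \] One can take $c=1$ if $k\le p$ and $c=2^{1-|S_{k,M}|}$ if $k>p$.
   Context: $S_{k,M}=\{z\in[0,p-1]^M: z_1+\cdots+z_M<k\}$ (sum in $\mathbb{Z}$), viewed as a subset of $\mathbb{F}_p^M$ via the identification of $\mathbb{F}_p$ with $\{0,\ldots,p-1\}$. $\Phi_{k,M}$ is the system of linear forms in the $M+1$ variables $(x,t_1,\ldots,t_M)$ given by $\phi_z(x,t_1,\ldots,t_M)=x+z_1t_1+\cdots+z_Mt_M$ for $z\in S_{k,M}$, and $\Lambda_{\Phi_{k,M}}((f_z)_z)=\mathbb{E}_{x,t_1,\ldots,t_M\in\mathbb{F}_p^n}\prod_{z\in S_{k,M}}f_z(x+z_1t_1+\cdots+z_Mt_M)$. A function is $1$-bounded if its modulus is at most $1$ everywhere. For $s\ge1$, $\|f\|_{U^s}^{2^s}=\mathbb{E}_{x,h_1,\ldots,h_s\in\mathbb{F}_p^n}\prod_{\omega\in\{0,1\}^s}\mathcal{C}^{|\omega|}f(x+\omega_1h_1+\cdots+\omega_sh_s)$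 ($\mathcal{C}$ = complex conjugation). True complexity: for a system $\Psi=\{\psi_1,\ldots,\psi_r\}$ of linear forms over $\mathbb{F}_p$ with average $\Lambda_\Psi(f_1,\ldots,f_r)=\mathbb{E}_{x\in(\mathbb{F}_p^n)^d}\prod_j f_j(\psi_j(x))$, $\Psi$ has true complexity at most $s$ if there is a function $\varepsilon:\mathbb{R}_{>0}\to\mathbb{R}_{>0}$ with $\varepsilon(\delta)\to0$ as $\delta\to0$ such that for all $n$ and all $1$-bounded $f_1,\ldots,f_r:\mathbb{F}_p^n\to\mathbb{C}$ one has $|\Lambda_\Psi(f_1,\ldots,f_r)|\le\min_{i\in[r]}\varepsilon(\|f_i\|_{U^{s+1}})$; the true complexity is the least such integer $s$. *)

theory Defs
  imports
    Complex_Main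
    "HOL-Library.FuncSet"
    "Jordan_Normal_Form.Matrix"
    "Berlekamp_Zassenhaus.Finite_Field"
begin

text \<open>
  The prime \<open>p\<close> is \<open>CARD('p)\<close> for a type \<open>'p\<close> of class \<^class>\<open>prime_card\<close>, the field
  \<open>F_p\<close> is \<open>'p mod_ring\<close>, and the identification of \<open>F_p\<close> with \<open>{0,...,p-1}\<close> is
  \<^const>\<open>to_int_mod_ring\<close>.  The space \<open>F_p^n\<close> is \<open>carrier_vec n\<close>, so that \<open>n\<close> can be
  quantified inside a formula; a function on \<open>F_p^n\<close> is a HOL function of which only
  the values on \<open>carrier_vec n\<close> are ever used.
\<close>

type_synonym 'p fp_vec = "'p mod_ring vec"

definition avg :: "'a set \<Rightarrow> ('a \<Rightarrow> complex) \<Rightarrow> complex" where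
  "avg A f = (\<Sum>x\<in>A. f x) / of_nat (card A)"

definition one_bounded :: "nat \<Rightarrow> ('p::prime_card fp_vec \<Rightarrow> complex) \<Rightarrow> bool" where
  "one_bounded n f \<longleftrightarrow> (\<forall>x\<in>carrier_vec n. cmod (f x) \<le> 1)"

text \<open>The \<open>d\<close>-tuples of vectors of \<open>F_p^n\<close>.\<close>

definition tuples :: "nat \<Rightarrow> nat \<Rightarrow> (nat \<Rightarrow> 'p::prime_card fp_vec) set" where
  "tuples n d = {..<d} \<rightarrow>\<^sub>E carrier_vec n"

text \<open>
  A vertex \<open>\<omega>\<close> of the cube \<open>{0,1}^s\<close> is encoded by its support, a subset of \<open>{..<s}\<close>.
  The average below is a nonnegative real number, so taking the real part only
  changes its type.  The norm is meant for \<open>s \<ge> 1\<close>.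
\<close>

definition gowers_norm :: "nat \<Rightarrow> nat \<Rightarrow> ('p::prime_card fp_vec \<Rightarrow> complex) \<Rightarrow> real" where
  "gowers_norm n s f =
     root (2 ^ s) (Re (avg (carrier_vec n \<times> tuples n s)
       (\<lambda>(x, h). \<Prod>\<omega>\<in>Pow {..<s}.
          (cnj ^^ card \<omega>) (f (vec n (\<lambda>j. x $ j + (\<Sum>i\<in>\<omega>. h i $ j)))))))"

text \<open>
  A linear form in \<open>d\<close> variables is given by its coefficient vector \<open>a\<close>, of dimension \<open>d\<close>;
  \<open>lin_form n a v\<close> is its value \<open>a_0 v_0 + ... + a_{d-1} v_{d-1}\<close> at a tuple \<open>v\<close> of
  vectors of \<open>F_p^n\<close>.  A system of forms is a family \<open>\<psi>\<close> over a finite index set \<open>I\<close>.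
\<close>

definition lin_form :: "nat \<Rightarrow> 'p::prime_card fp_vec \<Rightarrow> (nat \<Rightarrow> 'p fp_vec) \<Rightarrow> 'p fp_vec" where
  "lin_form n a v = vec n (\<lambda>j. \<Sum>i<dim_vec a. a $ i * v i $ j)"

definition form_avg ::
  "nat \<Rightarrow> nat \<Rightarrow> 'i set \<Rightarrow> ('i \<Rightarrow> 'p::prime_card fp_vec) \<Rightarrow>
   ('i \<Rightarrow> 'p fp_vec \<Rightarrow> complex) \<Rightarrow> complex" where
  "form_avg n d I \<psi> f = avg (tuples n d) (\<lambda>v. \<Prod>i\<in>I. f i (lin_form n (\<psi> i) v))"

text \<open>
  The gauge \<open>\<epsilon>\<close> is a positive function on the positive reals with limit \<open>0\<close> at \<open>0\<close>.
  Since the norm of some \<open>f i\<close> may be \<open>0\<close>, \<open>\<epsilon>\<close> is extended to \<open>0\<close> by this limit.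
\<close>

definition true_complexity_at_most ::
  "nat \<Rightarrow> 'i set \<Rightarrow> ('i \<Rightarrow> 'p::prime_card fp_vec) \<Rightarrow> nat \<Rightarrow> bool" where
  "true_complexity_at_most d I \<psi> s \<longleftrightarrow>
     (\<exists>\<epsilon>::real \<Rightarrow> real. \<epsilon> 0 = 0 \<and> (\<forall>\<delta>>0. \<epsilon> \<delta> > 0) \<and> (\<epsilon> \<longlongrightarrow> 0) (at_right 0) \<and>
        (\<forall>n f. (\<forall>i\<in>I. one_bounded n (f i)) \<longrightarrow>
           (\<forall>i\<in>I. cmod (form_avg n d I \<psi> f) \<le> \<epsilon> (gowers_norm n (s + 1) (f i)))))"

definition has_true_complexity ::
  "nat \<Rightarrow> 'i set \<Rightarrow> ('i \<Rightarrow> 'p::prime_card fp_vec) \<Rightarrow> nat \<Rightarrow> bool" where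
  "has_true_complexity d I \<psi> s \<longleftrightarrow>
     true_complexity_at_most d I \<psi> s \<and> (\<forall>s'. true_complexity_at_most d I \<psi> s' \<longrightarrow> s \<le> s')"

definition S_set :: "nat \<Rightarrow> nat \<Rightarrow> 'p::prime_card fp_vec set" where
  "S_set k M = {z \<in> carrier_vec M. (\<Sum>i<M. to_int_mod_ring (z $ i)) < int k}"

text \<open>
  The form \<open>\<phi>_z\<close> has coefficients \<open>(1, z_1, ..., z_M)\<close> in the variables
  \<open>(x, t_1, ..., t_M)\<close>, which are the entries \<open>0, 1, ..., M\<close> of a tuple.
\<close>

definition Phi :: "'p::prime_card fp_vec \<Rightarrow> 'p fp_vec" where
  "Phi z = vCons 1 z"

lemma lin_form_Phi:
  fixes z :: "'p::prime_card fp_vec"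
  assumes "z \<in> carrier_vec M" and "v 0 \<in> carrier_vec n"
  shows "lin_form n (Phi z) v = v 0 + vec n (\<lambda>j. \<Sum>i<M. z $ i * v (Suc i) $ j)"
  using assms
  by (intro eq_vecI) (auto simp: lin_form_def Phi_def sum.lessThan_Suc_shift
    simp del: sum.lessThan_Suc)

definition Lambda_Phi ::
  "nat \<Rightarrow> nat \<Rightarrow> nat \<Rightarrow> ('p::prime_card fp_vec \<Rightarrow> 'p fp_vec \<Rightarrow> complex) \<Rightarrow> complex" where
  "Lambda_Phi k M n f = form_avg n (M + 1) (S_set k M) Phi f"

end

theory Submission
  imports Defs
begin

text \<open>
  \<^bold>\<open>Upper bound.\<close> Shifting the variables by \<open>u\<^sub>1 \<lambda>\<^sub>1 + \<dots> + u\<^sub>s \<lambda>\<^sub>s\<close>, where \<open>s = k - 1\<close> and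
  the \<open>\<lambda>\<^sub>l\<close> are functionals with \<open>\<lambda>\<^sub>l(\<phi>\<^sub>z) = 1\<close>, makes every form killed by some \<open>\<lambda>\<^sub>l\<close>
  independent of \<open>u\<^sub>l\<close>, and Gowers--Cauchy--Schwarz bounds the average by the norm of \<open>f\<^sub>z\<close>.
  The functionals \<open>w \<mapsto> (w\<^sub>i - j) / (z\<^sub>i - j)\<close> with \<open>j < z\<^sub>i\<close> kill all \<open>w \<noteq> z\<close> with
  \<open>|w| \<le> |z|\<close>; for \<open>k \<le> p\<close> the remaining \<open>w\<close> are killed by \<open>w \<mapsto> (|w| - j) / (|z| - j)\<close>
  with \<open>|z| < j < k\<close>.  For \<open>k > p\<close> the \<open>f\<^sub>w\<close> are treated by decreasing \<open>|w|\<close>: one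
  Cauchy--Schwarz replaces \<open>f\<^sub>w\<close> by its dual function, which along the \<open>s\<close> directions is an average
  of products of functions each ignoring one direction, hence harmless in all later steps.

  \<^bold>\<open>Lower bound.\<close> More than \<open>k - 2\<close> differences annihilate a product \<open>P\<close> of \<open>k - 2\<close> coordinates,
  which yields \<open>c\<^sub>z\<close>, not all zero, with \<open>\<Sum>\<^sub>z c\<^sub>z P(\<phi>\<^sub>z) = 0\<close>.  The phases of \<open>c\<^sub>z P\<close> have average
  \<open>1\<close>, while a \<open>U\<^sup>s\<close> norm with \<open>s \<le> k - 2\<close> of a nontrivial one is less than \<open>1\<close>, and tensor
  powers make it arbitrarily small.
\<close>

section \<open>Averages and the Gowers norms\<close>

lemma finite_carrier_vec [simp, intro]: "finite (carrier_vec n :: 'a::finite vec set)"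
proof -
  have "carrier_vec n \<subseteq> vec n ` ({..<n} \<rightarrow>\<^sub>E (UNIV :: 'a set))"
  proof
    fix x :: "'a vec" assume "x \<in> carrier_vec n"
    then have "x = vec n (\<lambda>i\<in>{..<n}. x $ i)" by (intro eq_vecI) simp_all
    moreover have "(\<lambda>i\<in>{..<n}. x $ i) \<in> {..<n} \<rightarrow>\<^sub>E (UNIV :: 'a set)" by simp
    ultimately show "x \<in> vec n ` ({..<n} \<rightarrow>\<^sub>E UNIV)" by (rule image_eqI)
  qed
  then show ?thesis by (rule finite_subset) (intro finite_imageI finite_PiE, auto)
qed

lemma carrier_vec_nonempty [simp]: "carrier_vec n \<noteq> {}"
  by (metis empty_iff vec_carrier)

lemma finite_tuples [simp, intro]: "finite (tuples n d :: (nat \<Rightarrow> 'p::prime_card fp_vec) set)"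
  unfolding tuples_def by (intro finite_PiE) auto

lemma tuples_nonempty [simp]: "tuples n d \<noteq> ({} :: (nat \<Rightarrow> 'p::prime_card fp_vec) set)"
  unfolding tuples_def by (simp add: PiE_eq_empty_iff)

lemma tuples_0 [simp]: "tuples n 0 = {\<lambda>_. undefined}"
  unfolding tuples_def by simp

lemma tuplesD [simp]: "u \<in> tuples n s \<Longrightarrow> l < s \<Longrightarrow> u l \<in> carrier_vec n"
  unfolding tuples_def by auto

lemma tuplesD_dim [simp]: "u \<in> tuples n s \<Longrightarrow> l < s \<Longrightarrow> dim_vec (u l) = n"
  using carrier_vecD tuplesD by blast

lemma tuples_restrict [intro]:
  "(\<And>l. l < s \<Longrightarrow> g l \<in> carrier_vec n) \<Longrightarrow> (\<lambda>l\<in>{..<s}. g l) \<in> tuples n s"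
  unfolding tuples_def by auto

lemma tuples_upd_Suc: "u \<in> tuples n s \<Longrightarrow> a \<in> carrier_vec n \<Longrightarrow> u(s := a) \<in> tuples n (Suc s)"
  unfolding tuples_def by (auto simp: PiE_iff extensional_def less_Suc_eq)

definition mean :: "'a set \<Rightarrow> ('a \<Rightarrow> real) \<Rightarrow> real" where
  "mean A f = (\<Sum>x\<in>A. f x) / real (card A)"

lemma avg_cong [cong]: "A = B \<Longrightarrow> (\<And>x. x \<in> B \<Longrightarrow> f x = g x) \<Longrightarrow> avg A f = avg B g"
  unfolding avg_def by (auto cong: sum.cong)

lemma avg_const [simp]: "finite A \<Longrightarrow> A \<noteq> {} \<Longrightarrow> avg A (\<lambda>_. c) = c"
  unfolding avg_def by simp

lemma avg_singleton [simp]: "avg {a} f = f a"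
  unfolding avg_def by simp

lemma avg_Times: "avg (A \<times> B) f = avg A (\<lambda>a. avg B (\<lambda>b. f (a, b)))"
  unfolding avg_def
  by (simp add: sum.cartesian_product' sum_divide_distrib[symmetric] card_cartesian_product mult.commute)

lemma avg_swap: "avg A (\<lambda>a. avg B (f a)) = avg B (\<lambda>b. avg A (\<lambda>a. f a b))"
proof -
  have "(\<Sum>a\<in>A. \<Sum>b\<in>B. f a b) = (\<Sum>b\<in>B. \<Sum>a\<in>A. f a b)" by (rule sum.swap)
  then show ?thesis
    unfolding avg_def by (simp add: sum_divide_distrib[symmetric] mult.commute)
qed

lemma avg_bij: "bij_betw g A B \<Longrightarrow> avg A (\<lambda>x. f (g x)) = avg B f"
  unfolding avg_def by (simp add: bij_betw_same_card sum.reindex_bij_betw)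

lemma avg_mult_left: "avg A (\<lambda>x. c * f x) = c * avg A f"
  unfolding avg_def by (simp add: sum_distrib_left)

lemma avg_mult_right: "avg A (\<lambda>x. f x * c) = avg A f * c"
  unfolding avg_def by (simp add: sum_distrib_right)

lemma avg_cnj: "cnj (avg A f) = avg A (\<lambda>x. cnj (f x))"
  unfolding avg_def by simp

lemma Re_avg: "Re (avg A f) = mean A (\<lambda>x. Re (f x))"
  unfolding avg_def mean_def by simp

lemma Im_avg: "Im (avg A f) = mean A (\<lambda>x. Im (f x))"
  unfolding avg_def mean_def by simp

lemma cmod_avg_le_mean: "cmod (avg A f) \<le> mean A (\<lambda>x. cmod (f x))"
  unfolding avg_def mean_def by (simp add: norm_divide divide_right_mono norm_sum)

lemma mean_mono: "(\<And>x. x \<in> A \<Longrightarrow> f x \<le> g x) \<Longrightarrow> mean A f \<le> mean A g"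
  unfolding mean_def by (intro divide_right_mono sum_mono) auto

lemma mean_nonneg: "(\<And>x. x \<in> A \<Longrightarrow> 0 \<le> f x) \<Longrightarrow> 0 \<le> mean A f"
  unfolding mean_def by (intro divide_nonneg_nonneg sum_nonneg) auto

lemma mean_const [simp]: "finite A \<Longrightarrow> A \<noteq> {} \<Longrightarrow> mean A (\<lambda>_. c) = c"
  unfolding mean_def by simp

lemma cmod_avg_le:
  assumes "finite A" "A \<noteq> {}" "\<And>x. x \<in> A \<Longrightarrow> cmod (f x) \<le> c"
  shows "cmod (avg A f) \<le> c"
proof -
  have "cmod (avg A f) \<le> mean A (\<lambda>x. cmod (f x))" by (rule cmod_avg_le_mean)
  also have "\<dots> \<le> mean A (\<lambda>_. c)" by (intro mean_mono assms)
  finally show ?thesis using assms by simp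
qed

text \<open>The variance is nonnegative: expand the sum of \<open>(f x - m)\<^sup>2\<close> around
  the mean \<open>m\<close>.\<close>

lemma mean_power2_le:
  assumes "finite A"
  shows "(mean A f)\<^sup>2 \<le> mean A (\<lambda>x. (f x)\<^sup>2)"
proof (cases "A = {}")
  case False
  define m where "m = mean A f"
  have m: "(\<Sum>x\<in>A. f x) = m * real (card A)" "real (card A) > 0"
    unfolding m_def mean_def using False assms by (auto simp: card_gt_0_iff)
  have "0 \<le> (\<Sum>x\<in>A. (f x - m)\<^sup>2)" by (simp add: sum_nonneg)
  also have "\<dots> = (\<Sum>x\<in>A. (f x)\<^sup>2) - 2 * m * (\<Sum>x\<in>A. f x) + m\<^sup>2 * real (card A)"
    by (simp add: power2_diff sum.distrib sum_subtractf algebra_simps flip: sum_distrib_left sum_distrib_right)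
  also have "\<dots> = (\<Sum>x\<in>A. (f x)\<^sup>2) - m\<^sup>2 * real (card A)"
    unfolding m(1) by (simp add: power2_eq_square algebra_simps)
  finally show ?thesis
    unfolding m_def[symmetric] using m(2) by (simp add: mean_def field_simps)
qed (simp add: mean_def)

lemma mean_power_le:
  assumes "finite A" "\<And>x. x \<in> A \<Longrightarrow> 0 \<le> f x"
  shows "(mean A f) ^ (2 ^ s) \<le> mean A (\<lambda>x. f x ^ (2 ^ s))"
  using assms(2)
proof (induction s arbitrary: f)
  case (Suc s)
  have "(mean A f) ^ (2 ^ Suc s) = ((mean A f)\<^sup>2) ^ (2 ^ s)"
    by (simp add: power_mult)
  also have "\<dots> \<le> (mean A (\<lambda>x. (f x)\<^sup>2)) ^ (2 ^ s)"
    by (intro power_mono mean_power2_le assms) auto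
  also have "\<dots> \<le> mean A (\<lambda>x. ((f x)\<^sup>2) ^ (2 ^ s))"
    by (rule Suc.IH) auto
  finally show ?case by (simp add: power_mult)
qed simp

lemma avg_tuples_Suc:
  fixes F :: "(nat \<Rightarrow> 'p::prime_card fp_vec) \<Rightarrow> complex"
  shows "avg (tuples n (Suc s)) F = avg (carrier_vec n) (\<lambda>a. avg (tuples n s) (\<lambda>u. F (u(s := a))))"
proof -
  have eq: "tuples n (Suc s) = (\<lambda>(a, u). u(s := a)) ` (carrier_vec n \<times> tuples n s)"
    unfolding tuples_def lessThan_Suc PiE_insert_eq by simp
  have inj: "inj_on (\<lambda>(a, u). u(s := a)) (carrier_vec n \<times> tuples n s)"
    unfolding tuples_def by (rule inj_combinator) simp
  have "bij_betw (\<lambda>(a, u). u(s := a)) (carrier_vec n \<times> tuples n s) (tuples n (Suc s))"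
    unfolding bij_betw_def using eq inj by (intro conjI) (rule inj, rule eq[symmetric])
  from avg_bij[OF this, of F, symmetric] show ?thesis
    by (simp add: avg_Times)
qed

definition lcomb :: "nat \<Rightarrow> nat set \<Rightarrow> (nat \<Rightarrow> 'p mod_ring) \<Rightarrow> (nat \<Rightarrow> 'p::prime_card fp_vec) \<Rightarrow> 'p fp_vec" where
  "lcomb n I c u = vec n (\<lambda>j. \<Sum>i\<in>I. c i * u i $ j)"

abbreviation vsum :: "nat \<Rightarrow> nat \<Rightarrow> (nat \<Rightarrow> 'p::prime_card fp_vec) \<Rightarrow> 'p fp_vec" where
  "vsum n s u \<equiv> lcomb n {..<s} (\<lambda>_. 1) u"

lemma lcomb_carrier [simp]: "lcomb n I c u \<in> carrier_vec n"
  by (simp add: lcomb_def)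

lemma lcomb_dim [simp]: "dim_vec (lcomb n I c u) = n"
  by (simp add: lcomb_def)

lemma lcomb_index [simp]: "j < n \<Longrightarrow> lcomb n I c u $ j = (\<Sum>i\<in>I. c i * u i $ j)"
  by (simp add: lcomb_def)

lemma lin_form_carrier [simp]: "lin_form n a v \<in> carrier_vec n"
  by (simp add: lin_form_def)

lemma lin_form_dim [simp]: "dim_vec (lin_form n a v) = n"
  by (simp add: lin_form_def)

section \<open>Gowers norms through iterated multiplicative derivatives\<close>

definition mderiv :: "'p::prime_card fp_vec \<Rightarrow> ('p fp_vec \<Rightarrow> complex) \<Rightarrow> 'p fp_vec \<Rightarrow> complex" where
  "mderiv a f x = f x * cnj (f (x + a))"

text \<open>For \<open>s \<ge> 1\<close> this is the \<open>2^s\<close>-th power of the \<open>U^s\<close> norm.\<close>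

primrec gpow :: "nat \<Rightarrow> nat \<Rightarrow> ('p::prime_card fp_vec \<Rightarrow> complex) \<Rightarrow> complex" where
  "gpow n 0 f = avg (carrier_vec n) f"
| "gpow n (Suc s) f = avg (carrier_vec n) (\<lambda>a. gpow n s (mderiv a f))"

lemma gpow_cong:
  "(\<And>x. x \<in> carrier_vec n \<Longrightarrow> f x = g x) \<Longrightarrow> gpow n s f = gpow n s g"
proof (induction s arbitrary: f g)
  case (Suc s)
  have "gpow n s (mderiv a f) = gpow n s (mderiv a g)" if "a \<in> carrier_vec n" for a
    using that by (intro Suc.IH) (simp add: mderiv_def Suc.prems)
  then show ?case by simp
qed simp

lemma cnj_funpow_mult: "(cnj ^^ m) (a * b) = (cnj ^^ m) a * (cnj ^^ m) b"
  by (induction m) auto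

text \<open>Pair each vertex \<open>\<omega>\<close> of the smaller cube with
  \<open>insert s \<omega>\<close>: up to the conjugations of \<open>\<omega>\<close> the two
  factors multiply to \<open>mderiv a f\<close>, where \<open>a\<close> is the last direction. This
  turns the cube average into a recursion.\<close>

lemma avg_cube_eq_gpow:
  fixes f :: "'p::prime_card fp_vec \<Rightarrow> complex"
  shows "avg (carrier_vec n) (\<lambda>x. avg (tuples n s) (\<lambda>h. \<Prod>\<omega>\<in>Pow {..<s}.
    (cnj ^^ card \<omega>) (f (x + lcomb n \<omega> (\<lambda>_. 1) h)))) = gpow n s f"
proof (induction s arbitrary: f)
  case 0
  have "x + lcomb n {} (\<lambda>_. 1) h = x" if "x \<in> carrier_vec n" for x :: "'p fp_vec" and h
    using that by (intro eq_vecI) auto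
  then show ?case by simp
next
  case (Suc s)
  have key: "(\<Prod>\<omega>\<in>Pow {..<Suc s}. (cnj ^^ card \<omega>) (f (x + lcomb n \<omega> (\<lambda>_. 1) (h(s := a)))))
      = (\<Prod>\<omega>\<in>Pow {..<s}. (cnj ^^ card \<omega>) (mderiv a f (x + lcomb n \<omega> (\<lambda>_. 1) h)))"
    if a: "a \<in> carrier_vec n" and x: "x \<in> carrier_vec n" for a x :: "'p fp_vec" and h
  proof -
    let ?P = "\<lambda>\<omega>. (cnj ^^ card \<omega>) (f (x + lcomb n \<omega> (\<lambda>_. 1) (h(s := a))))"
    have "(\<Prod>\<omega>\<in>Pow {..<Suc s}. ?P \<omega>) = (\<Prod>\<omega>\<in>Pow {..<s}. ?P \<omega>) * (\<Prod>\<omega>\<in>insert s ` Pow {..<s}. ?P \<omega>)"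
      unfolding lessThan_Suc Pow_insert by (rule prod.union_disjoint) auto
    also have "(\<Prod>\<omega>\<in>insert s ` Pow {..<s}. ?P \<omega>) = (\<Prod>\<omega>\<in>Pow {..<s}. ?P (insert s \<omega>))"
      by (subst prod.reindex) (auto simp: inj_on_def)
    also have "(\<Prod>\<omega>\<in>Pow {..<s}. ?P \<omega>) * (\<Prod>\<omega>\<in>Pow {..<s}. ?P (insert s \<omega>)) =
        (\<Prod>\<omega>\<in>Pow {..<s}. ?P \<omega> * ?P (insert s \<omega>))"
      by (rule prod.distrib[symmetric])
    also have "\<dots> = (\<Prod>\<omega>\<in>Pow {..<s}. (cnj ^^ card \<omega>) (mderiv a f (x + lcomb n \<omega> (\<lambda>_. 1) h)))"
    proof (rule prod.cong[OF refl])
      fix \<omega> assume w: "\<omega> \<in> Pow {..<s}"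
      then have fin: "finite \<omega>" and ns: "s \<notin> \<omega>" by (auto intro: finite_subset)
      have e0: "(\<Sum>i\<in>\<omega>. (if i = s then a else h i) $ j) = (\<Sum>i\<in>\<omega>. h i $ j)" for j
        using ns by (intro sum.cong) auto
      have e1: "x + lcomb n \<omega> (\<lambda>_. 1) (h(s := a)) = x + lcomb n \<omega> (\<lambda>_. 1) h"
        using x e0 by (intro eq_vecI) auto
      have e2: "x + lcomb n (insert s \<omega>) (\<lambda>_. 1) (h(s := a)) = (x + lcomb n \<omega> (\<lambda>_. 1) h) + a"
        using x a fin ns e0 by (intro eq_vecI) (auto simp: algebra_simps)
      show "?P \<omega> * ?P (insert s \<omega>) = (cnj ^^ card \<omega>) (mderiv a f (x + lcomb n \<omega> (\<lambda>_. 1) h))"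
        unfolding e1 e2 using fin ns
        by (simp add: mderiv_def cnj_funpow_mult funpow_swap1)
    qed
    finally show ?thesis .
  qed
  have "avg (carrier_vec n) (\<lambda>x. avg (tuples n (Suc s)) (\<lambda>h. \<Prod>\<omega>\<in>Pow {..<Suc s}.
      (cnj ^^ card \<omega>) (f (x + lcomb n \<omega> (\<lambda>_. 1) h)))) =
    avg (carrier_vec n) (\<lambda>x. avg (carrier_vec n) (\<lambda>a. avg (tuples n s) (\<lambda>h. \<Prod>\<omega>\<in>Pow {..<s}.
      (cnj ^^ card \<omega>) (mderiv a f (x + lcomb n \<omega> (\<lambda>_. 1) h)))))"
    unfolding avg_tuples_Suc by (intro avg_cong refl key)
  also have "\<dots> = avg (carrier_vec n) (\<lambda>a. gpow n s (mderiv a f))"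
    unfolding Suc.IH[symmetric] by (rule avg_swap)
  finally show ?case by simp
qed

lemma gowers_norm_eq_gpow: "gowers_norm n s f = root (2 ^ s) (Re (gpow n s f))"
proof -
  have "vec n (\<lambda>j. x $ j + (\<Sum>i\<in>\<omega>. h i $ j)) = x + lcomb n \<omega> (\<lambda>_. 1) h"
    if "x \<in> carrier_vec n" for x :: "'a fp_vec" and h \<omega>
    using that by (intro eq_vecI) auto
  then show ?thesis
    unfolding gowers_norm_def avg_cube_eq_gpow[symmetric] avg_Times by simp
qed

text \<open>For one direction the value is \<open>avg f\<close> times its conjugate, and further
  directions only average such real values. The lower bound uses this to infer
  \<open>Re w < 1\<close> from \<open>w \<noteq> 1\<close>.\<close>

lemma Im_gpow_Suc: "Im (gpow n (Suc s) f) = 0"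
proof (induction s arbitrary: f)
  case 0
  let ?G = "carrier_vec n :: 'a fp_vec set"
  have bij: "bij_betw (\<lambda>a. x + a) ?G ?G" if "x \<in> ?G" for x
    using that by (intro bij_betwI[where g = "\<lambda>a. a - x"]) auto
  have "gpow n (Suc 0) f = avg ?G (\<lambda>x. avg ?G (\<lambda>a. f x * cnj (f (x + a))))"
    unfolding gpow.simps mderiv_def by (rule avg_swap)
  also have "\<dots> = avg ?G (\<lambda>x. f x * avg ?G (\<lambda>a. cnj (f a)))"
    unfolding avg_mult_left using avg_bij[OF bij, of _ "\<lambda>a. cnj (f a)"] by simp
  also have "\<dots> = avg ?G f * cnj (avg ?G f)"
    by (simp add: avg_mult_right avg_cnj)
  finally show ?case by (simp add: complex_mult_cnj)
next
  case (Suc s)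
  then show ?case unfolding gpow.simps(2)[of n "Suc s"] Im_avg by (simp add: mean_def del: gpow.simps)
qed

section \<open>The Gowers--Cauchy--Schwarz inequality\<close>

lemma bij_betw_add_vec:
  assumes "x \<in> carrier_vec n"
  shows "bij_betw (\<lambda>a. x + a) (carrier_vec n) (carrier_vec n :: 'a::ab_group_add vec set)"
proof (rule bij_betwI[where g = "\<lambda>a. a - x"])
  fix a :: "'a vec" assume "a \<in> carrier_vec n"
  then show "x + a - x = a" and "x + (a - x) = a"
    using assms by (auto intro!: eq_vecI)
qed (use assms in auto)

lemma avg_translate:
  fixes f :: "'p::prime_card fp_vec \<Rightarrow> complex"
  assumes "x \<in> carrier_vec n"
  shows "avg (carrier_vec n) (\<lambda>a. f (x + a)) = avg (carrier_vec n) f"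
  using bij_betw_add_vec[OF assms] by (rule avg_bij)

lemma power2_cmod_avg:
  fixes f :: "'p::prime_card fp_vec \<Rightarrow> complex"
  shows "complex_of_real ((cmod (avg (carrier_vec n) f))\<^sup>2) =
    avg (carrier_vec n) (\<lambda>a. avg (carrier_vec n) (\<lambda>h. f a * cnj (f (a + h))))"
proof -
  have "avg (carrier_vec n) (\<lambda>a. avg (carrier_vec n) (\<lambda>h. f a * cnj (f (a + h)))) =
      avg (carrier_vec n) (\<lambda>a. f a * avg (carrier_vec n) (\<lambda>h. cnj (f h)))"
    unfolding avg_mult_left by (intro avg_cong refl arg_cong2[where f = "(*)"] avg_translate)
  also have "\<dots> = avg (carrier_vec n) f * cnj (avg (carrier_vec n) f)"
    by (simp add: avg_mult_right avg_cnj)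
  finally show ?thesis by (simp only: complex_norm_square)
qed

definition box_factor :: "nat \<Rightarrow> nat \<Rightarrow> nat \<Rightarrow> ((nat \<Rightarrow> 'p::prime_card fp_vec) \<Rightarrow> complex) \<Rightarrow> bool" where
  "box_factor n s l B \<longleftrightarrow> (\<forall>u\<in>tuples n s. cmod (B u) \<le> 1 \<and> (\<forall>a\<in>carrier_vec n. B (u(l := a)) = B u))"

text \<open>For fixed first \<open>s\<close> coordinates the factor \<open>B s\<close> is constant
  in the last one and at most 1 in modulus, so it drops out. Squaring the remaining average over the
  last coordinate replaces \<open>f\<close> and the other \<open>B l\<close> by derivatives in a
  direction \<open>h\<close>.\<close>

lemma box_cs_step:
  fixes f :: "'p::prime_card fp_vec \<Rightarrow> complex"
  assumes y: "y \<in> carrier_vec n" and B: "\<And>l. l < Suc s \<Longrightarrow> box_factor n (Suc s) l (B l)"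
  defines "B' \<equiv> \<lambda>h a l u. B l (u(s := a)) * cnj (B l (u(s := a + h)))"
  shows "(cmod (avg (tuples n (Suc s)) (\<lambda>u. f (y + vsum n (Suc s) u) * (\<Prod>l<Suc s. B l u))))\<^sup>2
    \<le> Re (avg (carrier_vec n) (\<lambda>h. avg (carrier_vec n) (\<lambda>a.
        avg (tuples n s) (\<lambda>u. mderiv h f ((y + a) + vsum n s u) * (\<Prod>l<s. B' h a l u)))))"
proof -
  let ?G = "carrier_vec n :: 'p fp_vec set" and ?T = "tuples n s :: (nat \<Rightarrow> 'p fp_vec) set"
  define Q where "Q u a = f (y + a + vsum n s u) * (\<Prod>l<s. B l (u(s := a)))" for u a
  \<comment> \<open>Since \<open>B s\<close> ignores coordinate \<open>s\<close>, its value is read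
    off at the representative \<open>0\<^sub>v n\<close>.\<close>
  have last: "cmod (B s (u(s := 0\<^sub>v n))) \<le> 1" "B s (u(s := a)) = B s (u(s := 0\<^sub>v n))"
    if u: "u \<in> ?T" and a: "a \<in> ?G" for u a
  proof -
    have z: "u(s := 0\<^sub>v n) \<in> tuples n (Suc s)" using u by (rule tuples_upd_Suc) simp
    show "cmod (B s (u(s := 0\<^sub>v n))) \<le> 1"
      using B[of s] z unfolding box_factor_def by blast
    have "B s ((u(s := 0\<^sub>v n))(s := a)) = B s (u(s := 0\<^sub>v n))"
      using B[of s] z a unfolding box_factor_def by blast
    then show "B s (u(s := a)) = B s (u(s := 0\<^sub>v n))" by simp
  qed
  have vs: "y + vsum n (Suc s) (u(s := a)) = y + a + vsum n s u" if "a \<in> ?G" "u \<in> ?T" for a u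
    using y that by (intro eq_vecI) auto
  have "avg (tuples n (Suc s)) (\<lambda>u. f (y + vsum n (Suc s) u) * (\<Prod>l<Suc s. B l u)) =
      avg ?G (\<lambda>a. avg ?T (\<lambda>u. f (y + vsum n (Suc s) (u(s := a))) * (\<Prod>l<Suc s. B l (u(s := a)))))"
    by (rule avg_tuples_Suc)
  also have "\<dots> = avg ?G (\<lambda>a. avg ?T (\<lambda>u. B s (u(s := 0\<^sub>v n)) * Q u a))"
    by (intro avg_cong refl) (simp only: vs Q_def prod.lessThan_Suc last mult_ac)
  also have "\<dots> = avg ?T (\<lambda>u. B s (u(s := 0\<^sub>v n)) * avg ?G (Q u))"
    unfolding avg_mult_left[symmetric] by (rule avg_swap)
  finally have eq: "avg (tuples n (Suc s)) (\<lambda>u. f (y + vsum n (Suc s) u) * (\<Prod>l<Suc s. B l u)) =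
    avg ?T (\<lambda>u. B s (u(s := 0\<^sub>v n)) * avg ?G (Q u))" (is "?X = _") .
  have "cmod ?X \<le> mean ?T (\<lambda>u. cmod (B s (u(s := 0\<^sub>v n)) * avg ?G (Q u)))"
    unfolding eq by (rule cmod_avg_le_mean)
  also have "\<dots> \<le> mean ?T (\<lambda>u. cmod (avg ?G (Q u)))"
  proof (rule mean_mono)
    fix u assume u: "u \<in> ?T"
    have "cmod (B s (u(s := 0\<^sub>v n))) \<le> 1" by (rule last(1)[OF u zero_carrier_vec])
    then show "cmod (B s (u(s := 0\<^sub>v n)) * avg ?G (Q u)) \<le> cmod (avg ?G (Q u))"
      unfolding norm_mult by (rule mult_left_le_one_le[OF norm_ge_zero norm_ge_zero])
  qed
  finally have "(cmod ?X)\<^sup>2 \<le> (mean ?T (\<lambda>u. cmod (avg ?G (Q u))))\<^sup>2"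
    by (rule power_mono) simp
  also have "\<dots> \<le> mean ?T (\<lambda>u. (cmod (avg ?G (Q u)))\<^sup>2)"
    by (rule mean_power2_le) simp
  also have "\<dots> = Re (avg ?T (\<lambda>u. complex_of_real ((cmod (avg ?G (Q u)))\<^sup>2)))"
    unfolding Re_avg by simp
  also have "avg ?T (\<lambda>u. complex_of_real ((cmod (avg ?G (Q u)))\<^sup>2)) =
      avg ?T (\<lambda>u. avg ?G (\<lambda>a. avg ?G (\<lambda>h. Q u a * cnj (Q u (a + h)))))"
    unfolding power2_cmod_avg ..
  also have "\<dots> = avg ?G (\<lambda>h. avg ?G (\<lambda>a. avg ?T (\<lambda>u. Q u a * cnj (Q u (a + h)))))"
    by (subst avg_swap, subst (2) avg_swap, rule avg_swap)
  also have "\<dots> = avg ?G (\<lambda>h. avg ?G (\<lambda>a.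
        avg ?T (\<lambda>u. mderiv h f ((y + a) + vsum n s u) * (\<Prod>l<s. B' h a l u))))"
  proof (intro avg_cong refl)
    fix h a u assume h: "h \<in> ?G" and a: "a \<in> ?G" and u: "u \<in> ?T"
    have "y + (a + h) + vsum n s u = y + a + vsum n s u + h"
      using y h a by (intro eq_vecI) (auto simp: algebra_simps)
    then show "Q u a * cnj (Q u (a + h)) = mderiv h f ((y + a) + vsum n s u) * (\<Prod>l<s. B' h a l u)"
      unfolding Q_def B'_def mderiv_def by (simp add: prod.distrib mult_ac)
  qed
  finally show ?thesis .
qed

lemma box_factor_deriv:
  fixes B :: "(nat \<Rightarrow> 'p::prime_card fp_vec) \<Rightarrow> complex"
  assumes B: "box_factor n (Suc s) l B" and l: "l < s" and h: "h \<in> carrier_vec n" and a: "a \<in> carrier_vec n"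
  shows "box_factor n s l (\<lambda>u. B (u(s := a)) * cnj (B (u(s := a + h))))"
  unfolding box_factor_def
proof (intro ballI conjI)
  have b: "cmod (B (u(s := c))) \<le> 1" "B (u(s := c, l := b)) = B (u(s := c))"
    if "u \<in> tuples n s" "c \<in> carrier_vec n" "b \<in> carrier_vec n" for u b c
  proof -
    have "u(s := c) \<in> tuples n (Suc s)" using that by (intro tuples_upd_Suc)
    then show "cmod (B (u(s := c))) \<le> 1" "B (u(s := c, l := b)) = B (u(s := c))"
      using B that unfolding box_factor_def by blast+
  qed
  fix u :: "nat \<Rightarrow> 'p fp_vec" assume u: "u \<in> tuples n s"
  have "cmod (B (u(s := a))) * cmod (B (u(s := a + h))) \<le> 1 * 1"
    using b(1)[OF u _ a] a h by (intro mult_mono) auto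
  then show "cmod (B (u(s := a)) * cnj (B (u(s := a + h)))) \<le> 1"
    by (simp add: norm_mult)
  fix b' :: "'p fp_vec" assume "b' \<in> carrier_vec n"
  then have "B (u(l := b', s := c)) = B (u(s := c))" if "c \<in> carrier_vec n" for c
    using b(2)[OF u that, of b'] l by (simp add: fun_upd_twist)
  then show "B ((u(l := b'))(s := a)) * cnj (B ((u(l := b'))(s := a + h))) =
      B (u(s := a)) * cnj (B (u(s := a + h)))"
    using a h by simp
qed

text \<open>Each Cauchy--Schwarz step removes the factor independent of the last coordinate.\<close>

lemma box_cs:
  fixes f :: "'p::prime_card fp_vec \<Rightarrow> complex"
  assumes "y \<in> carrier_vec n" "\<And>l. l < Suc s \<Longrightarrow> box_factor n (Suc s) l (B l)"
  shows "cmod (avg (tuples n (Suc s)) (\<lambda>u. f (y + vsum n (Suc s) u) * (\<Prod>l<Suc s. B l u))) ^ (2 ^ Suc s)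
    \<le> Re (gpow n (Suc s) f)"
  using assms
proof (induction s arbitrary: f y B)
  case 0
  have "y + a + vsum n 0 (\<lambda>_. undefined) = y + a" if "a \<in> carrier_vec n" for a
    using 0(1) that by (intro eq_vecI) auto
  then show ?case
    using box_cs_step[OF 0, of f] avg_translate[OF 0(1)] by (simp del: lessThan_Suc)
next
  case (Suc s)
  let ?G = "carrier_vec n :: 'p fp_vec set"
  define B' where "B' h a l u = B l (u(Suc s := a)) * cnj (B l (u(Suc s := a + h)))" for h a l u
  define T where "T h a = avg (tuples n (Suc s)) (\<lambda>u. mderiv h f ((y + a) + vsum n (Suc s) u) *
    (\<Prod>l<Suc s. B' h a l u))" for h a
  let ?X = "avg (tuples n (Suc (Suc s))) (\<lambda>u. f (y + vsum n (Suc (Suc s)) u) * (\<Prod>l<Suc (Suc s). B l u))"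
  have T: "cmod (T h a) ^ (2 ^ Suc s) \<le> Re (gpow n (Suc s) (mderiv h f))"
    if "h \<in> ?G" "a \<in> ?G" for h a
    unfolding T_def
  proof (rule Suc.IH)
    show "y + a \<in> ?G" using that Suc.prems(1) by simp
    show "box_factor n (Suc s) l (B' h a l)" if "l < Suc s" for l
      unfolding B'_def by (rule box_factor_deriv) (use that \<open>h \<in> ?G\<close> \<open>a \<in> ?G\<close> Suc.prems(2) in auto)
  qed
  have "(cmod ?X)\<^sup>2 \<le> Re (avg ?G (\<lambda>h. avg ?G (\<lambda>a. T h a)))"
    unfolding T_def B'_def by (rule box_cs_step[OF Suc.prems])
  also have "\<dots> \<le> mean ?G (\<lambda>h. mean ?G (\<lambda>a. cmod (T h a)))"
    unfolding Re_avg by (intro mean_mono complex_Re_le_cmod)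
  finally have "((cmod ?X)\<^sup>2) ^ (2 ^ Suc s) \<le> (mean ?G (\<lambda>h. mean ?G (\<lambda>a. cmod (T h a)))) ^ (2 ^ Suc s)"
    by (rule power_mono) simp
  \<comment> \<open>Jensen moves the exponent inside the averages, where the induction hypothesis
    bounds each \<open>T h a\<close> separately.\<close>
  also have "\<dots> \<le> mean ?G (\<lambda>h. (mean ?G (\<lambda>a. cmod (T h a))) ^ (2 ^ Suc s))"
    by (intro mean_power_le mean_nonneg) auto
  also have "\<dots> \<le> mean ?G (\<lambda>h. mean ?G (\<lambda>a. cmod (T h a) ^ (2 ^ Suc s)))"
    by (intro mean_mono mean_power_le) auto
  also have "\<dots> \<le> mean ?G (\<lambda>h. mean ?G (\<lambda>a. Re (gpow n (Suc s) (mderiv h f))))"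
    by (intro mean_mono T)
  also have "\<dots> = Re (gpow n (Suc (Suc s)) f)"
    unfolding gpow.simps(2)[of n "Suc s"] Re_avg by (simp del: gpow.simps)
  finally show ?case by (simp only: power_mult[symmetric] power_Suc)
qed

text \<open>With all factors equal to 1, \<open>box_cs\<close> puts a power of a modulus below the
  real part.\<close>

lemma gpow_nonneg: "0 < s \<Longrightarrow> 0 \<le> Re (gpow n s f)"
proof -
  assume "0 < s"
  then obtain r where s: "s = Suc r" by (cases s) auto
  have "0 \<le> cmod (avg (tuples n s) (\<lambda>u. f (0\<^sub>v n + vsum n s u) * (\<Prod>l<s. (\<lambda>_ _. 1) l u))) ^ (2 ^ s)"
    by simp
  also have "\<dots> \<le> Re (gpow n s f)"
    unfolding s by (rule box_cs) (auto simp: box_factor_def)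
  finally show ?thesis .
qed

lemma gowers_norm_nonneg: "0 < s \<Longrightarrow> 0 \<le> gowers_norm n s f"
  unfolding gowers_norm_eq_gpow by (simp add: gpow_nonneg)

section \<open>Antiuniform functions\<close>

text \<open>Closing products of box factors under averages costs nothing in Gowers--Cauchy--Schwarz
  and admits dual functions. Equality is asked for on \<open>tuples n s\<close> only; the index sets
  consist of tuples because dual functions are averages over \<open>tuples n d\<close>.\<close>

inductive box_hull :: "nat \<Rightarrow> nat \<Rightarrow> ((nat \<Rightarrow> 'p::prime_card fp_vec) \<Rightarrow> complex) \<Rightarrow> bool" for n s where
  prod: "\<lbrakk>\<And>l. l < s \<Longrightarrow> box_factor n s l (B l); \<And>u. u \<in> tuples n s \<Longrightarrow> K u = (\<Prod>l<s. B l u)\<rbrakk>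
    \<Longrightarrow> box_hull n s K"
| avg: "\<lbrakk>finite A; A \<noteq> {}; \<And>a. a \<in> A \<Longrightarrow> box_hull n s (K' a);
    \<And>u. u \<in> tuples n s \<Longrightarrow> K u = avg (A :: (nat \<Rightarrow> 'p fp_vec) set) (\<lambda>a. K' a u)\<rbrakk>
    \<Longrightarrow> box_hull n s K"

lemma box_hull_factor:
  assumes "box_factor n s l K" "l < s"
  shows "box_hull n s K"
proof (rule box_hull.prod[where B = "\<lambda>i. if i = l then K else (\<lambda>_. 1)"])
  show "K u = (\<Prod>i<s. (if i = l then K else (\<lambda>_. 1)) u)" for u
    using assms(2) by (simp add: if_distrib[of "\<lambda>f. f u"] cong: if_cong)
qed (use assms in \<open>auto simp: box_factor_def\<close>)

lemma box_factor_mult: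
  assumes "box_factor n s l B" "box_factor n s l C"
  shows "box_factor n s l (\<lambda>u. B u * C u)"
  using assms unfolding box_factor_def by (simp add: norm_mult mult_le_one)

text \<open>By nested induction averages are pulled out of either argument, until two products
  remain whose factors are multiplied direction by direction.\<close>

lemma box_hull_mult:
  assumes "box_hull n s K" "box_hull n s L"
  shows "box_hull n s (\<lambda>u. K u * L u)"
  using assms
proof (induction rule: box_hull.induct)
  case (prod B K)
  note K = prod(1,2)
  from prod(3) show ?case
  proof (induction rule: box_hull.induct)
    case (prod C L)
    show ?case
      by (rule box_hull.prod[where B = "\<lambda>l u. B l u * C l u"])
        (simp_all add: K prod box_factor_mult prod.distrib)
  next
    case (avg A L' L)
    show ?case
      by (rule box_hull.avg[OF avg(1,2), where K' = "\<lambda>a u. K u * L' a u"])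
        (simp_all add: avg avg_mult_left)
  qed
next
  case (avg A K' K)
  show ?case
    by (rule box_hull.avg[OF avg(1,2), where K' = "\<lambda>a u. K' a u * L u"])
      (simp_all add: avg avg_mult_right)
qed

lemma box_hull_prod:
  assumes "finite J" "0 < s" "\<And>w. w \<in> J \<Longrightarrow> box_hull n s (K w)"
  shows "box_hull n s (\<lambda>u. \<Prod>w\<in>J. K w u)"
  using assms(1,3)
proof (induction J rule: finite_induct)
  case empty
  show ?case by (rule box_hull_factor[OF _ \<open>0 < s\<close>]) (simp add: box_factor_def)
next
  case (insert w J)
  have "box_hull n s (\<lambda>u. K w u * (\<Prod>w\<in>J. K w u))"
    by (intro box_hull_mult insert.IH insert.prems) auto
  then show ?case using insert by simp
qed

lemma box_hull_cnj: "box_hull n s K \<Longrightarrow> box_hull n s (\<lambda>u. cnj (K u))"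
proof (induction rule: box_hull.induct)
  case (prod B K)
  show ?case
    by (rule box_hull.prod[where B = "\<lambda>l u. cnj (B l u)"])
      (use prod in \<open>simp_all add: box_factor_def\<close>)
next
  case (avg A K' K)
  show ?case
    by (rule box_hull.avg[OF avg(1,2), where K' = "\<lambda>a u. cnj (K' a u)"])
      (use avg in \<open>simp_all add: avg_cnj\<close>)
qed

text \<open>Scaling each direction separately respects independence of a coordinate. The case
  \<open>c l = 0\<close> is included, since a coefficient \<open>\<psi> w \<bullet> lam l\<close>
  may vanish.\<close>

lemma box_hull_scale:
  fixes c :: "nat \<Rightarrow> 'p::prime_card mod_ring"
  assumes "box_hull n s K"
  shows "box_hull n s (\<lambda>u. K (\<lambda>l\<in>{..<s}. c l \<cdot>\<^sub>v u l))"
proof -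
  have T: "(\<lambda>l\<in>{..<s}. c l \<cdot>\<^sub>v u l) \<in> tuples n s" if "u \<in> tuples n s" for u :: "nat \<Rightarrow> 'p fp_vec"
    using that by auto
  show ?thesis using assms
  proof (induction rule: box_hull.induct)
    case (prod B K)
    have F: "box_factor n s l (\<lambda>u. B l (\<lambda>l\<in>{..<s}. c l \<cdot>\<^sub>v u l))" if l: "l < s" for l
      unfolding box_factor_def
    proof (intro ballI conjI)
      fix u :: "nat \<Rightarrow> 'p fp_vec" assume u: "u \<in> tuples n s"
      show "cmod (B l (\<lambda>l\<in>{..<s}. c l \<cdot>\<^sub>v u l)) \<le> 1"
        using prod(1)[OF l] T[OF u] unfolding box_factor_def by blast
      fix a :: "'p fp_vec" assume a: "a \<in> carrier_vec n"
      have "(\<lambda>i\<in>{..<s}. c i \<cdot>\<^sub>v (u(l := a)) i) = (\<lambda>l\<in>{..<s}. c l \<cdot>\<^sub>v u l)(l := c l \<cdot>\<^sub>v a)"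
        using l by (auto simp: fun_eq_iff)
      then show "B l (\<lambda>i\<in>{..<s}. c i \<cdot>\<^sub>v (u(l := a)) i) = B l (\<lambda>l\<in>{..<s}. c l \<cdot>\<^sub>v u l)"
        using prod(1)[OF l] T[OF u] a unfolding box_factor_def by simp
    qed
    show ?case
      by (rule box_hull.prod[where B = "\<lambda>l u. B l (\<lambda>l\<in>{..<s}. c l \<cdot>\<^sub>v u l)"],
        rule F, assumption, rule prod(2)[OF T])
  next
    case (avg A K' K)
    show ?case
      by (rule box_hull.avg[OF avg.hyps(1,2) avg.IH], assumption, rule avg.hyps(4)[OF T])
  qed
qed

lemma box_hull_bounded:
  assumes "box_hull n s K" "u \<in> tuples n s"
  shows "cmod (K u) \<le> 1"
  using assms
proof (induction rule: box_hull.induct)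
  case (prod B K)
  have "(\<Prod>l<s. cmod (B l u)) \<le> 1"
    by (rule prod_le_1) (use prod in \<open>auto simp: box_factor_def\<close>)
  with prod show ?case by (simp add: prod_norm)
next
  case (avg A K' K)
  then show ?case by (simp add: cmod_avg_le)
qed

text \<open>For a product \<open>K\<close> this is the \<open>2 ^ s\<close>-th root of
  \<open>box_cs\<close>; the bound is independent of \<open>K\<close>, so it survives
  averaging.\<close>

lemma box_hull_cs:
  fixes f :: "'p::prime_card fp_vec \<Rightarrow> complex"
  assumes "box_hull n s K" and y: "y \<in> carrier_vec n" and s: "0 < s"
  shows "cmod (avg (tuples n s) (\<lambda>u. f (y + vsum n s u) * K u)) \<le> gowers_norm n s f"
  using assms(1)
proof (induction rule: box_hull.induct)
  case (prod B K)
  obtain r where r: "s = Suc r" using s by (cases s) auto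
  let ?X = "avg (tuples n s) (\<lambda>u. f (y + vsum n s u) * (\<Prod>l<s. B l u))"
  have "cmod ?X ^ (2 ^ s) \<le> Re (gpow n s f)"
    unfolding r by (rule box_cs[OF y]) (use prod(1) r in auto)
  then have "root (2 ^ s) (cmod ?X ^ (2 ^ s)) \<le> gowers_norm n s f"
    unfolding gowers_norm_eq_gpow by (intro real_root_le_mono) auto
  then have "cmod ?X \<le> gowers_norm n s f"
    by (simp add: real_root_power_cancel)
  then show ?case using prod(2) by simp
next
  case (avg A K' K)
  have "avg (tuples n s) (\<lambda>u. f (y + vsum n s u) * K u) =
      avg (tuples n s) (\<lambda>u. avg A (\<lambda>a. f (y + vsum n s u) * K' a u))"
    by (simp add: avg avg_mult_left)
  also have "\<dots> = avg A (\<lambda>a. avg (tuples n s) (\<lambda>u. f (y + vsum n s u) * K' a u))"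
    by (rule avg_swap)
  finally show ?case using avg by (simp add: cmod_avg_le)
qed

text \<open>Dual to the \<open>U^s\<close> norm: along any \<open>s\<close> directions, \<open>D\<close> is an average of products
  of functions each of which ignores one of the directions.\<close>

definition antiuniform :: "nat \<Rightarrow> nat \<Rightarrow> ('p::prime_card fp_vec \<Rightarrow> complex) \<Rightarrow> bool" where
  "antiuniform n s D \<longleftrightarrow> (\<forall>y\<in>carrier_vec n. box_hull n s (\<lambda>u. D (y + vsum n s u)))"

lemma antiuniform_lcomb:
  assumes "antiuniform n s D" "y \<in> carrier_vec n"
  shows "box_hull n s (\<lambda>u. D (y + lcomb n {..<s} c u))"
proof -
  have "vsum n s (\<lambda>l\<in>{..<s}. c l \<cdot>\<^sub>v u l) = lcomb n {..<s} c u" if "u \<in> tuples n s" for u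
    using that by (intro eq_vecI) auto
  moreover have "box_hull n s (\<lambda>u. D (y + vsum n s (\<lambda>l\<in>{..<s}. c l \<cdot>\<^sub>v u l)))"
    using box_hull_scale[of n s "\<lambda>u. D (y + vsum n s u)" c] assms unfolding antiuniform_def by blast
  \<comment> \<open>Averaging over a one-point set serves to pass to a function that agrees on
    \<open>tuples n s\<close>.\<close>
  ultimately show ?thesis
    using box_hull.avg[of "{\<lambda>_. undefined}" n s "\<lambda>_ u. D (y + vsum n s (\<lambda>l\<in>{..<s}. c l \<cdot>\<^sub>v u l))"]
    by simp
qed

lemma antiuniform_bounded:
  fixes D :: "'p::prime_card fp_vec \<Rightarrow> complex"
  assumes "antiuniform n s D"
  shows "one_bounded n D"
  unfolding one_bounded_def
proof
  fix y :: "'p fp_vec" assume y: "y \<in> carrier_vec n"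
  define u :: "nat \<Rightarrow> 'p fp_vec" where "u = (\<lambda>l\<in>{..<s}. 0\<^sub>v n)"
  have u: "u \<in> tuples n s" unfolding u_def by auto
  have "y + vsum n s u = y" using y by (intro eq_vecI) (auto simp: u_def)
  then show "cmod (D y) \<le> 1"
    using box_hull_bounded[OF _ u, of "\<lambda>u. D (y + vsum n s u)"] assms y unfolding antiuniform_def by auto
qed

lemma antiuniform_cnj: "antiuniform n s D \<Longrightarrow> antiuniform n s (\<lambda>x. cnj (D x))"
  unfolding antiuniform_def by (auto intro: box_hull_cnj)

section \<open>Systems of linear forms\<close>

text \<open>The restriction to \<open>{..<d}\<close> keeps the sum extensional, hence inside
  \<open>tuples n d\<close>.\<close>

definition tadd :: "nat \<Rightarrow> (nat \<Rightarrow> 'p::prime_card fp_vec) \<Rightarrow> (nat \<Rightarrow> 'p fp_vec) \<Rightarrow> nat \<Rightarrow> 'p fp_vec" where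
  "tadd d v w = (\<lambda>i\<in>{..<d}. v i + w i)"

lemma tadd_tuples [simp]: "v \<in> tuples n d \<Longrightarrow> w \<in> tuples n d \<Longrightarrow> tadd d v w \<in> tuples n d"
  unfolding tadd_def by auto

lemma avg_tadd:
  fixes F :: "(nat \<Rightarrow> 'p::prime_card fp_vec) \<Rightarrow> complex"
  assumes w: "w \<in> tuples n d"
  shows "avg (tuples n d) (\<lambda>v. F (tadd d v w)) = avg (tuples n d) F"
proof (rule avg_bij, rule bij_betwI[where g = "\<lambda>v. \<lambda>i\<in>{..<d}. v i - w i"])
  fix v :: "nat \<Rightarrow> 'p fp_vec" assume v: "v \<in> tuples n d"
  have eq: "v i + w i - w i = v i" "v i - w i + w i = v i" if "i < d" for i
    using tuplesD_dim[OF v that] tuplesD_dim[OF w that] by (auto intro!: eq_vecI)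
  have out: "v i = undefined" if "\<not> i < d" for i
    using v that unfolding tuples_def by (auto simp: PiE_iff extensional_def)
  show "(\<lambda>i\<in>{..<d}. tadd d v w i - w i) = v" "tadd d (\<lambda>i\<in>{..<d}. v i - w i) w = v"
    unfolding tadd_def using eq out by (auto simp: fun_eq_iff)
qed (use w in auto)

lemma lin_form_tadd:
  assumes "a \<in> carrier_vec d" "v \<in> tuples n d" "w \<in> tuples n d"
  shows "lin_form n a (tadd d v w) = lin_form n a v + lin_form n a w"
  using assms by (intro eq_vecI) (auto simp: lin_form_def tadd_def algebra_simps sum.distrib)

text \<open>Exchange the two sums. The direction \<open>u l\<close> moves the form \<open>a\<close>
  by \<open>a \<bullet> lam l\<close> times \<open>u l\<close>, so it goes unnoticed when
  \<open>lam l\<close> kills \<open>a\<close>.\<close>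

lemma lin_form_lcomb:
  assumes "a \<in> carrier_vec d" "\<And>l. l < s \<Longrightarrow> lam l \<in> carrier_vec d"
  shows "lin_form n a (\<lambda>i\<in>{..<d}. lcomb n {..<s} (\<lambda>l. lam l $ i) u) =
    lcomb n {..<s} (\<lambda>l. a \<bullet> lam l) u"
proof (rule eq_vecI)
  fix j assume "j < dim_vec (lcomb n {..<s} (\<lambda>l. a \<bullet> lam l) u)"
  then have j: "j < n" by simp
  have "lin_form n a (\<lambda>i\<in>{..<d}. lcomb n {..<s} (\<lambda>l. lam l $ i) u) $ j =
      (\<Sum>i<d. \<Sum>l<s. a $ i * (lam l $ i * u l $ j))"
    using j assms(1) by (simp add: lin_form_def sum_distrib_left)
  also have "\<dots> = (\<Sum>l<s. \<Sum>i<d. a $ i * (lam l $ i * u l $ j))"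
    by (rule sum.swap)
  also have "\<dots> = (\<Sum>l<s. (a \<bullet> lam l) * u l $ j)"
  proof (rule sum.cong[OF refl])
    fix l assume "l \<in> {..<s}"
    then have "dim_vec (lam l) = d" using assms(2) by auto
    then show "(\<Sum>i<d. a $ i * (lam l $ i * u l $ j)) = (a \<bullet> lam l) * u l $ j"
      by (simp add: scalar_prod_def sum_distrib_right mult.assoc lessThan_atLeast0)
  qed
  finally show "lin_form n a (\<lambda>i\<in>{..<d}. lcomb n {..<s} (\<lambda>l. lam l $ i) u) $ j =
      lcomb n {..<s} (\<lambda>l. a \<bullet> lam l) u $ j"
    using j by simp
qed simp

lemma lin_form_smult:
  assumes "a \<in> carrier_vec d" "b \<in> carrier_vec d" "c \<in> carrier_vec n"
  shows "lin_form n a (\<lambda>i\<in>{..<d}. b $ i \<cdot>\<^sub>v c) = (a \<bullet> b) \<cdot>\<^sub>v c"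
  using assms
  by (intro eq_vecI) (auto simp: lin_form_def scalar_prod_def sum_distrib_right mult.assoc lessThan_atLeast0)

section \<open>Separated forms and dual functions\<close>

locale form_system =
  fixes n d s :: nat and I :: "'i set" and \<psi> :: "'i \<Rightarrow> 'p::prime_card fp_vec"
  assumes finI: "finite I" and psi: "\<And>w. w \<in> I \<Longrightarrow> \<psi> w \<in> carrier_vec d" and s_pos: "0 < s"
begin

text \<open>The functionals \<open>lam\<close> certify that, apart from antiuniform functions, the forms other
  than \<open>\<psi> i\<close> split into \<open>s\<close> classes whose linear spans do not contain \<open>\<psi> i\<close>.\<close>

definition separated :: "'i \<Rightarrow> (nat \<Rightarrow> 'p fp_vec) \<Rightarrow> 'i set \<Rightarrow> bool" where
  "separated i lam E \<longleftrightarrow> (\<forall>l<s. lam l \<in> carrier_vec d \<and> \<psi> i \<bullet> lam l = 1) \<and>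
     (\<forall>w\<in>I - E - {i}. \<exists>l<s. \<psi> w \<bullet> lam l = 0)"

text \<open>The average of the other factors over the fibre \<open>{v. \<psi> i (v) = y}\<close>, which is
  parametrised by projecting all tuples to it along \<open>lam 0\<close>.\<close>

definition dual :: "'i \<Rightarrow> (nat \<Rightarrow> 'p fp_vec) \<Rightarrow> ('i \<Rightarrow> 'p fp_vec \<Rightarrow> complex) \<Rightarrow> 'p fp_vec \<Rightarrow> complex" where
  "dual i lam F y = avg (tuples n d) (\<lambda>v. \<Prod>w\<in>I - {i}.
     F w (lin_form n (\<psi> w) v + (\<psi> w \<bullet> lam 0) \<cdot>\<^sub>v (y - lin_form n (\<psi> i) v)))"

context
  fixes i lam E and F :: "'i \<Rightarrow> 'p fp_vec \<Rightarrow> complex"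
  assumes i: "i \<in> I" and sep: "separated i lam E"
    and bdd: "\<And>w. w \<in> I \<Longrightarrow> one_bounded n (F w)"
    and anti: "\<And>w. w \<in> E \<Longrightarrow> antiuniform n s (F w)"
begin

lemma lam: "l < s \<Longrightarrow> lam l \<in> carrier_vec d" "l < s \<Longrightarrow> \<psi> i \<bullet> lam l = 1"
  using sep unfolding separated_def by auto

abbreviation shift :: "(nat \<Rightarrow> 'p fp_vec) \<Rightarrow> nat \<Rightarrow> 'p fp_vec" where
  "shift u \<equiv> (\<lambda>j\<in>{..<d}. lcomb n {..<s} (\<lambda>l. lam l $ j) u)"

lemma shift_tuples: "shift u \<in> tuples n d"
  by auto

lemma lin_form_shift:
  assumes "w \<in> I" "v \<in> tuples n d"
  shows "lin_form n (\<psi> w) (tadd d v (shift u)) = lin_form n (\<psi> w) v + lcomb n {..<s} (\<lambda>l. \<psi> w \<bullet> lam l) u"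
  using assms lam(1) by (simp only: lin_form_tadd[OF psi _ shift_tuples] lin_form_lcomb[OF psi])

lemma lcomb_i: "lcomb n {..<s} (\<lambda>l. \<psi> i \<bullet> lam l) u = vsum n s u"
  by (intro eq_vecI) (simp_all add: lam(2))

text \<open>Each factor is antiuniform or ignores a direction \<open>l\<close> with
  \<open>\<psi> w \<bullet> lam l = 0\<close>; both kinds lie in the hull, and so does their
  product.\<close>

lemma box_hull_others:
  assumes y: "\<And>w. w \<in> I \<Longrightarrow> y w \<in> carrier_vec n"
  shows "box_hull n s (\<lambda>u. \<Prod>w\<in>I - {i}. F w (y w + lcomb n {..<s} (\<lambda>l. \<psi> w \<bullet> lam l) u))"
proof (rule box_hull_prod)
  fix w assume w: "w \<in> I - {i}"
  show "box_hull n s (\<lambda>u. F w (y w + lcomb n {..<s} (\<lambda>l. \<psi> w \<bullet> lam l) u))"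
  proof (cases "w \<in> E")
    case True
    then show ?thesis using anti y w by (intro antiuniform_lcomb) auto
  next
    case False
    then obtain l where l: "l < s" "\<psi> w \<bullet> lam l = 0"
      using sep w unfolding separated_def by auto
    have "lcomb n {..<s} (\<lambda>l. \<psi> w \<bullet> lam l) (u(l := a)) = lcomb n {..<s} (\<lambda>l. \<psi> w \<bullet> lam l) u" for u a
      using l(2) by (intro eq_vecI) (auto intro!: sum.cong)
    then show ?thesis
      using bdd[of w] y[of w] w l(1)
      by (intro box_hull_factor[of _ _ l]) (auto simp: box_factor_def one_bounded_def)
  qed
qed (use finI s_pos in auto)

text \<open>Averaging over the shifts by \<open>u\<close> does not change \<open>form_avg\<close>.
  For fixed \<open>v\<close> the form \<open>\<psi> i\<close> moves by \<open>vsum n s u\<close>,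
  the remaining factors form a member of the hull, and \<open>box_hull_cs\<close> applies.\<close>

lemma form_avg_le_gowers_norm: "cmod (form_avg n d I \<psi> F) \<le> gowers_norm n s (F i)"
proof -
  let ?T = "tuples n s :: (nat \<Rightarrow> 'p fp_vec) set" and ?V = "tuples n d :: (nat \<Rightarrow> 'p fp_vec) set"
  define Q where "Q v = (\<Prod>w\<in>I. F w (lin_form n (\<psi> w) v))" for v
  define K where "K v u = (\<Prod>w\<in>I - {i}. F w (lin_form n (\<psi> w) v + lcomb n {..<s} (\<lambda>l. \<psi> w \<bullet> lam l) u))" for v u
  have Q: "Q (tadd d v (shift u)) = F i (lin_form n (\<psi> i) v + vsum n s u) * K v u" if "v \<in> ?V" for v u
  proof -
    have "(\<Prod>w\<in>I - {i}. F w (lin_form n (\<psi> w) (tadd d v (shift u)))) = K v u"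
      unfolding K_def by (intro prod.cong refl) (simp add: lin_form_shift that)
    then show ?thesis
      unfolding Q_def prod.remove[OF finI i] lin_form_shift[OF i that] lcomb_i by simp
  qed
  have "form_avg n d I \<psi> F = avg ?T (\<lambda>u. avg ?V Q)"
    unfolding form_avg_def Q_def by simp
  also have "\<dots> = avg ?T (\<lambda>u. avg ?V (\<lambda>v. Q (tadd d v (shift u))))"
    by (simp only: avg_tadd[OF shift_tuples])
  also have "\<dots> = avg ?V (\<lambda>v. avg ?T (\<lambda>u. Q (tadd d v (shift u))))"
    by (rule avg_swap)
  also have "\<dots> = avg ?V (\<lambda>v. avg ?T (\<lambda>u. F i (lin_form n (\<psi> i) v + vsum n s u) * K v u))"
    by (intro avg_cong refl Q)
  also have "cmod \<dots> \<le> gowers_norm n s (F i)"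
    unfolding K_def
    by (intro cmod_avg_le box_hull_cs box_hull_others s_pos) auto
  finally show ?thesis .
qed

text \<open>Translating the variables by \<open>c\<close> along \<open>lam 0\<close> moves
  \<open>\<psi> i\<close> by \<open>c\<close> itself, so for every \<open>v\<close> the value
  \<open>lin_form n (\<psi> i) v + c\<close> is uniform and can be renamed \<open>y\<close>.\<close>

lemma form_avg_eq_dual: "form_avg n d I \<psi> F = avg (carrier_vec n) (\<lambda>y. F i y * dual i lam F y)"
proof -
  let ?G = "carrier_vec n :: 'p fp_vec set" and ?V = "tuples n d :: (nat \<Rightarrow> 'p fp_vec) set"
  define Q where "Q v = (\<Prod>w\<in>I. F w (lin_form n (\<psi> w) v))" for v
  define sh where "sh c = (\<lambda>j\<in>{..<d}. lam 0 $ j \<cdot>\<^sub>v c)" for c :: "'p fp_vec"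
  define R where "R v y = F i y * (\<Prod>w\<in>I - {i}.
    F w (lin_form n (\<psi> w) v + (\<psi> w \<bullet> lam 0) \<cdot>\<^sub>v (y - lin_form n (\<psi> i) v)))" for v y
  have sh: "sh c \<in> ?V" if "c \<in> ?G" for c using that unfolding sh_def by auto
  have lf: "lin_form n (\<psi> w) (tadd d v (sh c)) = lin_form n (\<psi> w) v + (\<psi> w \<bullet> lam 0) \<cdot>\<^sub>v c"
    if "w \<in> I" "v \<in> ?V" "c \<in> ?G" for w v c
    using lin_form_tadd[OF psi[OF that(1)] that(2) sh[OF that(3)]]
      lin_form_smult[OF psi[OF that(1)] lam(1)[OF s_pos] that(3)]
    unfolding sh_def by simp
  have Q: "Q (tadd d v (sh c)) = R v (lin_form n (\<psi> i) v + c)" if v: "v \<in> ?V" and c: "c \<in> ?G" for v c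
  proof -
    have "lin_form n (\<psi> i) v + c - lin_form n (\<psi> i) v = c" using c by (intro eq_vecI) auto
    moreover have "(\<Prod>w\<in>I - {i}. F w (lin_form n (\<psi> w) (tadd d v (sh c)))) =
        (\<Prod>w\<in>I - {i}. F w (lin_form n (\<psi> w) v + (\<psi> w \<bullet> lam 0) \<cdot>\<^sub>v c))"
      by (intro prod.cong refl) (simp add: lf v c)
    moreover have "lin_form n (\<psi> i) (tadd d v (sh c)) = lin_form n (\<psi> i) v + c"
      using lf[OF i v c] lam(2)[OF s_pos] by simp
    ultimately show ?thesis
      unfolding Q_def R_def prod.remove[OF finI i] by simp
  qed
  have "form_avg n d I \<psi> F = avg ?G (\<lambda>c. avg ?V Q)"
    unfolding form_avg_def Q_def by simp
  also have "\<dots> = avg ?G (\<lambda>c. avg ?V (\<lambda>v. Q (tadd d v (sh c))))"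
    by (intro avg_cong refl avg_tadd[symmetric] sh)
  also have "\<dots> = avg ?V (\<lambda>v. avg ?G (\<lambda>c. Q (tadd d v (sh c))))"
    by (rule avg_swap)
  also have "\<dots> = avg ?V (\<lambda>v. avg ?G (\<lambda>c. R v (lin_form n (\<psi> i) v + c)))"
    by (intro avg_cong refl Q)
  also have "\<dots> = avg ?V (\<lambda>v. avg ?G (R v))"
    by (intro avg_cong refl avg_translate) simp
  also have "\<dots> = avg ?G (\<lambda>y. avg ?V (\<lambda>v. R v y))"
    by (rule avg_swap)
  finally show ?thesis unfolding R_def dual_def avg_mult_left .
qed

text \<open>Shift the averaging variable \<open>v\<close> by \<open>u\<close> along with the
  argument: the difference of the argument and \<open>\<psi> i\<close> at \<open>v\<close> is
  unchanged, so every other form moves by its own \<open>\<psi> w \<bullet> lam l\<close>, as in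
  \<open>box_hull_others\<close>.\<close>

lemma antiuniform_dual: "antiuniform n s (dual i lam F)"
  unfolding antiuniform_def
proof
  let ?V = "tuples n d :: (nat \<Rightarrow> 'p fp_vec) set"
  fix y :: "'p fp_vec" assume y: "y \<in> carrier_vec n"
  define R where "R y v = (\<Prod>w\<in>I - {i}.
    F w (lin_form n (\<psi> w) v + (\<psi> w \<bullet> lam 0) \<cdot>\<^sub>v (y - lin_form n (\<psi> i) v)))" for v y
  have "dual i lam F (y + vsum n s u) = avg ?V (\<lambda>v. \<Prod>w\<in>I - {i}.
    F w ((lin_form n (\<psi> w) v + (\<psi> w \<bullet> lam 0) \<cdot>\<^sub>v (y - lin_form n (\<psi> i) v))
      + lcomb n {..<s} (\<lambda>l. \<psi> w \<bullet> lam l) u))" for u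
  proof -
    have "dual i lam F (y + vsum n s u) = avg ?V (R (y + vsum n s u))"
      unfolding dual_def R_def ..
    also have "\<dots> = avg ?V (\<lambda>v. R (y + vsum n s u) (tadd d v (shift u)))"
      by (rule avg_tadd[OF shift_tuples, symmetric])
    also have "\<dots> = avg ?V (\<lambda>v. \<Prod>w\<in>I - {i}.
      F w ((lin_form n (\<psi> w) v + (\<psi> w \<bullet> lam 0) \<cdot>\<^sub>v (y - lin_form n (\<psi> i) v))
        + lcomb n {..<s} (\<lambda>l. \<psi> w \<bullet> lam l) u))"
      unfolding R_def
    proof (intro avg_cong refl prod.cong)
      fix v w assume v: "v \<in> ?V" and w: "w \<in> I - {i}"
      have "(y + vsum n s u) - lin_form n (\<psi> i) (tadd d v (shift u)) = y - lin_form n (\<psi> i) v"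
        unfolding lin_form_shift[OF i v] lcomb_i using y by (intro eq_vecI) auto
      moreover have "lin_form n (\<psi> w) (tadd d v (shift u)) =
          lin_form n (\<psi> w) v + lcomb n {..<s} (\<lambda>l. \<psi> w \<bullet> lam l) u"
        using w v by (intro lin_form_shift) auto
      moreover have "lin_form n (\<psi> w) v + lcomb n {..<s} (\<lambda>l. \<psi> w \<bullet> lam l) u +
            (\<psi> w \<bullet> lam 0) \<cdot>\<^sub>v (y - lin_form n (\<psi> i) v) =
          lin_form n (\<psi> w) v + (\<psi> w \<bullet> lam 0) \<cdot>\<^sub>v (y - lin_form n (\<psi> i) v) +
            lcomb n {..<s} (\<lambda>l. \<psi> w \<bullet> lam l) u"
        using y by (intro eq_vecI) auto
      ultimately show "F w (lin_form n (\<psi> w) (tadd d v (shift u)) + (\<psi> w \<bullet> lam 0) \<cdot>\<^sub>v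
            (y + vsum n s u - lin_form n (\<psi> i) (tadd d v (shift u)))) =
          F w ((lin_form n (\<psi> w) v + (\<psi> w \<bullet> lam 0) \<cdot>\<^sub>v (y - lin_form n (\<psi> i) v))
            + lcomb n {..<s} (\<lambda>l. \<psi> w \<bullet> lam l) u)"
        by (simp only:)
    qed
    finally show ?thesis .
  qed
  then show "box_hull n s (\<lambda>u. dual i lam F (y + vsum n s u))"
    by (intro box_hull.avg[OF finite_tuples tuples_nonempty box_hull_others]) (use y in auto)
qed

end

text \<open>The form average is the mean of \<open>F i\<close> times its dual function. As
  \<open>F i\<close> is 1-bounded, Cauchy--Schwarz bounds the square by the mean squared modulus of
  the dual, which is the form average with the conjugate dual in place of
  \<open>F i\<close>.\<close>

lemma antiuniform_replacement:
  assumes i: "i \<in> I" and sep: "separated i lam E"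
    and bdd: "\<And>w. w \<in> I \<Longrightarrow> one_bounded n (F w)"
    and anti: "\<And>w. w \<in> E \<Longrightarrow> antiuniform n s (F w)"
  shows "\<exists>D. antiuniform n s D \<and>
    (cmod (form_avg n d I \<psi> F))\<^sup>2 \<le> cmod (form_avg n d I \<psi> (F(i := D)))"
proof -
  let ?G = "carrier_vec n :: 'p fp_vec set"
  define D where "D = dual i lam F"
  have D: "antiuniform n s D"
    unfolding D_def by (rule antiuniform_dual[OF i sep bdd anti])
  let ?D = "\<lambda>x. cnj (D x)"
  have bD: "one_bounded n ?D"
    by (rule antiuniform_bounded[OF antiuniform_cnj[OF D]])
  have sep': "separated i lam (E - {i})"
    using sep unfolding separated_def by auto
  have "form_avg n d I \<psi> (F(i := ?D)) = avg ?G (\<lambda>y. (F(i := ?D)) i y * dual i lam (F(i := ?D)) y)"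
    by (rule form_avg_eq_dual[OF i sep']) (use bdd bD anti in auto)
  \<comment> \<open>The dual at \<open>i\<close> involves only the functions at the other
    indices.\<close>
  also have "dual i lam (F(i := ?D)) = D"
  proof
    show "dual i lam (F(i := ?D)) y = D y" for y
      unfolding D_def dual_def by (intro avg_cong refl prod.cong) simp
  qed
  also have "avg ?G (\<lambda>y. (F(i := ?D)) i y * D y) = avg ?G (\<lambda>y. complex_of_real ((cmod (D y))\<^sup>2))"
    by (simp add: complex_norm_square mult.commute del: of_real_power)
  also have "\<dots> = complex_of_real (mean ?G (\<lambda>y. (cmod (D y))\<^sup>2))"
    by (simp add: complex_eq_iff Re_avg Im_avg del: of_real_power)
  finally have form_eq: "form_avg n d I \<psi> (F(i := ?D)) = complex_of_real (mean ?G (\<lambda>y. (cmod (D y))\<^sup>2))" .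
  have eq: "cmod (form_avg n d I \<psi> (F(i := ?D))) = mean ?G (\<lambda>y. (cmod (D y))\<^sup>2)"
    unfolding form_eq by (simp add: mean_nonneg)
  have "cmod (form_avg n d I \<psi> F) = cmod (avg ?G (\<lambda>y. F i y * D y))"
    unfolding D_def by (subst form_avg_eq_dual[OF i sep bdd anti]) auto
  also have "\<dots> \<le> mean ?G (\<lambda>y. cmod (F i y * D y))"
    by (rule cmod_avg_le_mean)
  also have "\<dots> \<le> mean ?G (\<lambda>y. cmod (D y))"
    using bdd[OF i] by (intro mean_mono) (simp add: norm_mult one_bounded_def mult_left_le_one_le)
  finally have "(cmod (form_avg n d I \<psi> F))\<^sup>2 \<le> (mean ?G (\<lambda>y. cmod (D y)))\<^sup>2"
    by (rule power_mono) simp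
  also have "\<dots> \<le> mean ?G (\<lambda>y. (cmod (D y))\<^sup>2)"
    by (rule mean_power2_le) simp
  finally show ?thesis
    using eq D antiuniform_cnj by (intro exI[of _ ?D]) auto
qed

lemma cmod_form_avg_le_1:
  assumes "\<And>w. w \<in> I \<Longrightarrow> one_bounded n (F w)"
  shows "cmod (form_avg n d I \<psi> F) \<le> 1"
  unfolding form_avg_def
proof (rule cmod_avg_le)
  fix v :: "nat \<Rightarrow> 'p fp_vec"
  have "(\<Prod>w\<in>I. cmod (F w (lin_form n (\<psi> w) v))) \<le> 1"
    by (rule prod_le_1) (use assms in \<open>auto simp: one_bounded_def\<close>)
  then show "cmod (\<Prod>w\<in>I. F w (lin_form n (\<psi> w) v)) \<le> 1" by (simp add: prod_norm)
qed auto

text \<open>A form of maximal weight outside \<open>E\<close> is separated from the remaining ones, so its function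
  may be replaced by an antiuniform one at the cost of a square, until \<open>i\<close> itself is maximal.\<close>

lemma form_avg_power_le_gowers_norm:
  fixes weight :: "'i \<Rightarrow> nat"
  assumes sep: "\<And>z. z \<in> I \<Longrightarrow> \<exists>lam. separated z lam {w. weight z < weight w}"
    and "\<And>w. w \<in> I \<Longrightarrow> one_bounded n (F w)" "\<And>w. w \<in> E \<Longrightarrow> antiuniform n s (F w)"
    and "i \<in> I - E"
  shows "cmod (form_avg n d I \<psi> F) ^ (2 ^ (card (I - E) - 1)) \<le> gowers_norm n s (F i)"
  using assms(2-)
proof (induction "card (I - E)" arbitrary: E F rule: less_induct)
  case less
  have finE: "finite (I - E)" using finI by simp
  have "\<exists>z\<in>I - E. \<forall>w\<in>I - E. weight w \<le> weight z"
  proof -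
    have "Max (weight ` (I - E)) \<in> weight ` (I - E)" by (rule Max_in) (use finE less.prems in auto)
    then show ?thesis using finE by (metis (no_types, lifting) Max_ge finite_imageI imageE imageI)
  qed
  then obtain z where z: "z \<in> I - E" and max: "\<And>w. w \<in> I - E \<Longrightarrow> weight w \<le> weight z" by blast
  obtain lam where "separated z lam {w. weight z < weight w}" using sep z by blast
  \<comment> \<open>By maximality every heavier form in \<open>I\<close> already belongs to
    \<open>E\<close>.\<close>
  then have lam: "separated z lam E" using max unfolding separated_def by (auto simp: not_less)
  show ?case
  proof (cases "z = i")
    case True
    have "cmod (form_avg n d I \<psi> F) ^ (2 ^ (card (I - E) - 1)) \<le> cmod (form_avg n d I \<psi> F) ^ 1"
      by (intro power_decreasing cmod_form_avg_le_1 less.prems) auto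
    also have "\<dots> \<le> gowers_norm n s (F i)"
      using form_avg_le_gowers_norm[OF _ lam] z True less.prems by simp
    finally show ?thesis .
  next
    case False
    obtain D where D: "antiuniform n s D"
      and le: "(cmod (form_avg n d I \<psi> F))\<^sup>2 \<le> cmod (form_avg n d I \<psi> (F(z := D)))"
      using antiuniform_replacement[OF _ lam, of F] z less.prems by blast
    have card: "card (I - E) = Suc (card (I - insert z E))"
      unfolding Diff_insert[of I z E] by (rule card.remove[OF finE z])
    \<comment> \<open>The index \<open>i\<close> survives, so the truncated subtraction in the
      exponent drops by exactly one and accounts for one squaring.\<close>
    have pos: "0 < card (I - insert z E)"
      using finE less.prems(3) False by (auto simp: card_gt_0_iff)
    have "cmod (form_avg n d I \<psi> F) ^ (2 ^ (card (I - E) - 1)) =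
        ((cmod (form_avg n d I \<psi> F))\<^sup>2) ^ (2 ^ (card (I - insert z E) - 1))"
      using pos unfolding card power_mult[symmetric] power_Suc[symmetric] by simp
    also have "\<dots> \<le> cmod (form_avg n d I \<psi> (F(z := D))) ^ (2 ^ (card (I - insert z E) - 1))"
      by (intro power_mono le) auto
    also have "\<dots> \<le> gowers_norm n s ((F(z := D)) i)"
      by (rule less.hyps[of "insert z E"]) (use card less.prems D antiuniform_bounded[OF D] False in auto)
    finally show ?thesis using False by simp
  qed
qed

end

section \<open>Separating functionals for \<open>\<Phi>\<close>\<close>

definition zdeg :: "nat \<Rightarrow> 'p::prime_card fp_vec \<Rightarrow> nat" where
  "zdeg M z = (\<Sum>i<M. nat (to_int_mod_ring (z $ i)))"

lemma to_int_mod_ring_bounds: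
  fixes a :: "'p::prime_card mod_ring"
  shows "0 \<le> to_int_mod_ring a" "to_int_mod_ring a < int CARD('p)"
  using range_to_int_mod_ring[where 'a = 'p] by (metis atLeastLessThan_iff rangeI)+

lemma of_nat_to_int_mod_ring:
  fixes a :: "'p::prime_card mod_ring"
  shows "of_nat (nat (to_int_mod_ring a)) = a"
  by (metis of_int_of_nat_eq nat_0_le of_int_mod_ring_to_int_mod_ring of_int_of_int_mod_ring to_int_mod_ring_bounds(1))

lemma to_int_mod_ring_of_nat:
  "m < CARD('p::prime_card) \<Longrightarrow> to_int_mod_ring (of_nat m :: 'p mod_ring) = int m"
  by (metis of_nat_0_le_iff of_nat_less_iff of_int_of_nat_eq of_int_of_int_mod_ring to_int_mod_ring_of_int_mod_ring)

lemma of_nat_mod_ring_eq_iff: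
  assumes "a < CARD('p::prime_card)" "b < CARD('p)"
  shows "(of_nat a :: 'p mod_ring) = of_nat b \<longleftrightarrow> a = b"
  by (metis assms to_int_mod_ring_of_nat of_nat_eq_iff)

lemma int_zdeg: "int (zdeg M z) = (\<Sum>i<M. to_int_mod_ring (z $ i))"
  unfolding zdeg_def by (simp add: to_int_mod_ring_bounds(1))

lemma S_set_eq: "S_set k M = {z \<in> carrier_vec M. zdeg M z < k}"
  unfolding S_set_def int_zdeg[symmetric] by simp

lemma of_nat_zdeg: "of_nat (zdeg M z) = (\<Sum>i<M. z $ i)"
  unfolding zdeg_def by (simp add: of_nat_to_int_mod_ring)

lemma finite_S_set: "finite (S_set k M :: 'p::prime_card fp_vec set)"
  unfolding S_set_def by (rule finite_subset[of _ "carrier_vec M"]) auto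

lemma Phi_carrier: "z \<in> carrier_vec M \<Longrightarrow> Phi z \<in> carrier_vec (Suc M)"
  unfolding Phi_def by simp

lemma Phi_scalar_prod:
  "z \<in> carrier_vec M \<Longrightarrow> b \<in> carrier_vec M \<Longrightarrow> Phi z \<bullet> vCons a b = a + z \<bullet> b"
  unfolding Phi_def by (simp add: scalar_prod_vCons)

lemma enumerate_functionals:
  assumes "finite L" "card L \<le> s" "\<And>x. x \<in> L \<Longrightarrow> P x" "P x0"
  obtains lam :: "nat \<Rightarrow> 'b" where "\<And>l. P (lam l)" "\<And>x. x \<in> L \<Longrightarrow> \<exists>l<s. lam l = x"
proof -
  obtain h where h: "bij_betw h {0..<card L} L"
    using ex_bij_betw_nat_finite[OF assms(1)] by blast
  define lam where "lam l = (if l < card L then h l else x0)" for l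
  show ?thesis
  proof
    show "P (lam l)" for l
      using assms(3,4) bij_betwE[OF h] by (auto simp: lam_def)
    show "\<exists>l<s. lam l = x" if "x \<in> L" for x
    proof -
      have "x \<in> h ` {0..<card L}" using h that by (simp add: bij_betw_def)
      then obtain l where "l < card L" "x = h l" by auto
      then show ?thesis using assms(2) by (intro exI[of _ l]) (auto simp: lam_def)
    qed
  qed
qed

text \<open>Affine functions of \<open>w\<close> are linear in \<open>Phi w = (1, w)\<close>: the
  constant term goes into the first coordinate. The denominator normalises the value at
  \<open>z\<close> to 1.\<close>

definition coord_functional :: "nat \<Rightarrow> 'p::prime_card fp_vec \<Rightarrow> nat \<times> nat \<Rightarrow> 'p fp_vec" where
  "coord_functional M z = (\<lambda>(i, j). vCons (- of_nat j / (z $ i - of_nat j))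
     ((1 / (z $ i - of_nat j)) \<cdot>\<^sub>v unit_vec M i))"

lemma coord_functional:
  assumes "i < M"
  shows "coord_functional M z (i, j) \<in> carrier_vec (Suc M)"
    and "w \<in> carrier_vec M \<Longrightarrow> Phi w \<bullet> coord_functional M z (i, j) = (w $ i - of_nat j) / (z $ i - of_nat j)"
  using assms by (auto simp: coord_functional_def Phi_scalar_prod diff_divide_distrib)

definition sum_functional :: "nat \<Rightarrow> 'p::prime_card fp_vec \<Rightarrow> nat \<Rightarrow> 'p fp_vec" where
  "sum_functional M z j = vCons (- of_nat j / (of_nat (zdeg M z) - of_nat j))
     (vec M (\<lambda>_. 1 / (of_nat (zdeg M z) - of_nat j)))"

lemma sum_functional:
  shows "sum_functional M z j \<in> carrier_vec (Suc M)"
    and "w \<in> carrier_vec M \<Longrightarrow> Phi w \<bullet> sum_functional M z j =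
      (of_nat (zdeg M w) - of_nat j) / (of_nat (zdeg M z) - of_nat j)"
proof -
  have "w \<bullet> vec M (\<lambda>_. c) = of_nat (zdeg M w) * c" if "w \<in> carrier_vec M" for w :: "'a fp_vec" and c
    unfolding of_nat_zdeg by (simp add: scalar_prod_def lessThan_atLeast0 sum_distrib_right)
  then show "w \<in> carrier_vec M \<Longrightarrow> Phi w \<bullet> sum_functional M z j =
      (of_nat (zdeg M w) - of_nat j) / (of_nat (zdeg M z) - of_nat j)"
    by (simp add: sum_functional_def Phi_scalar_prod diff_divide_distrib)
qed (simp add: sum_functional_def)

lemma sigma_digits_card:
  "card (SIGMA i:{..<M}. {..<nat (to_int_mod_ring (z $ i))}) = zdeg M z"
  unfolding zdeg_def by simp

lemma digit_less:
  fixes z :: "'p::prime_card fp_vec"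
  assumes "j < nat (to_int_mod_ring (z $ i))"
  shows "z $ i \<noteq> of_nat j"
proof
  assume "z $ i = of_nat j"
  moreover have "j < CARD('p)" using assms to_int_mod_ring_bounds(2)[of "z $ i"] by linarith
  ultimately have "to_int_mod_ring (z $ i) = int j" by (simp add: to_int_mod_ring_of_nat)
  then show False using assms by simp
qed

text \<open>If no digit of \<open>w\<close> lay below that of \<open>z\<close>, the bound on the
  digit sums would force all digits to agree.\<close>

lemma exists_smaller_digit:
  fixes w z :: "'p::prime_card fp_vec"
  assumes "w \<in> carrier_vec M" "z \<in> carrier_vec M" "w \<noteq> z" "zdeg M w \<le> zdeg M z"
  obtains i where "i < M" "nat (to_int_mod_ring (w $ i)) < nat (to_int_mod_ring (z $ i))"
proof -
  have "\<exists>i<M. nat (to_int_mod_ring (w $ i)) < nat (to_int_mod_ring (z $ i))"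
  proof (rule ccontr)
    assume "\<not> ?thesis"
    then have ge: "nat (to_int_mod_ring (z $ i)) \<le> nat (to_int_mod_ring (w $ i))" if "i < M" for i
      using that by (meson not_less)
    have eq: "nat (to_int_mod_ring (z $ i)) = nat (to_int_mod_ring (w $ i))" if "i < M" for i
    proof (rule ccontr)
      assume "\<not> ?thesis"
      then have "zdeg M z < zdeg M w"
        unfolding zdeg_def by (intro sum_strict_mono_ex1) (use ge that in \<open>auto simp: nat_less_le\<close>)
      then show False using assms(4) by simp
    qed
    have "w = z"
      using assms eq by (intro eq_vecI) (auto, metis of_nat_to_int_mod_ring)
    then show False using assms(3) by simp
  qed
  then show ?thesis using that by blast
qed

text \<open>There are \<open>zdeg M z\<close> pairs \<open>(i, j)\<close> with \<open>j\<close>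
  below digit \<open>i\<close> of \<open>z\<close>, and each element of \<open>J\<close> adds one
  functional. If digit \<open>i\<close> of \<open>w\<close> is such a \<open>j\<close>, the pair
  kills \<open>w\<close>; if the digit sum of \<open>w\<close> lies in \<open>J\<close>, its
  \<open>sum_functional\<close> does.\<close>

lemma separated_by_digits:
  fixes z :: "'p::prime_card fp_vec"
  assumes z: "z \<in> carrier_vec M" "zdeg M z + card J \<le> s" and J: "finite J"
    and Jz: "\<And>j. j \<in> J \<Longrightarrow> (of_nat j :: 'p mod_ring) \<noteq> of_nat (zdeg M z)"
  obtains lam :: "nat \<Rightarrow> 'p fp_vec" where
    "\<And>l. lam l \<in> carrier_vec (Suc M)" "\<And>l. Phi z \<bullet> lam l = 1"
    "\<And>w. w \<in> carrier_vec M \<Longrightarrow> w \<noteq> z \<Longrightarrow> zdeg M w \<le> zdeg M z \<or> zdeg M w \<in> J \<or>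
       (\<exists>i<M. nat (to_int_mod_ring (w $ i)) < nat (to_int_mod_ring (z $ i))) \<Longrightarrow>
       \<exists>l<s. Phi w \<bullet> lam l = 0"
proof -
  let ?D = "SIGMA i:{..<M}. {..<nat (to_int_mod_ring (z $ i))}"
  let ?L = "coord_functional M z ` ?D \<union> sum_functional M z ` J"
  let ?P = "\<lambda>x. x \<in> carrier_vec (Suc M) \<and> Phi z \<bullet> x = 1"
  have fin: "finite ?L" using J by auto
  have "card ?L \<le> card (coord_functional M z ` ?D) + card (sum_functional M z ` J)"
    by (rule card_Un_le)
  also have "\<dots> \<le> card ?D + card J"
    by (intro add_mono card_image_le J) auto
  also have "\<dots> \<le> s" using z(2) by (simp only: sigma_digits_card)
  finally have card: "card ?L \<le> s" .
  have P: "?P x" if "x \<in> ?L" for x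
    using that
  proof
    assume "x \<in> coord_functional M z ` ?D"
    then obtain i j where x: "x = coord_functional M z (i, j)" "i < M" "j < nat (to_int_mod_ring (z $ i))"
      by auto
    then show ?thesis using coord_functional(1)[OF x(2), where z = z and j = j]
        coord_functional(2)[OF x(2) z(1), where z = z and j = j] digit_less[OF x(3)] x(1) by simp
  next
    assume "x \<in> sum_functional M z ` J"
    then show ?thesis using sum_functional[where M = M and z = z] z(1) Jz by force
  qed
  \<comment> \<open>The padding functional is the first coordinate, which is 1 on every
    \<open>Phi w\<close>.\<close>
  have P0: "?P (vCons 1 (0\<^sub>v M))" using z(1) by (simp add: Phi_scalar_prod)
  obtain lam where lam: "\<And>l. ?P (lam l)" "\<And>x. x \<in> ?L \<Longrightarrow> \<exists>l<s. lam l = x"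
    using enumerate_functionals[of ?L s ?P, OF fin card P P0] by blast
  show ?thesis
  proof
    fix w :: "'p fp_vec"
    assume w: "w \<in> carrier_vec M" "w \<noteq> z" and "zdeg M w \<le> zdeg M z \<or> zdeg M w \<in> J \<or>
       (\<exists>i<M. nat (to_int_mod_ring (w $ i)) < nat (to_int_mod_ring (z $ i)))"
    then consider "zdeg M w \<in> J" | i where "i < M" "nat (to_int_mod_ring (w $ i)) < nat (to_int_mod_ring (z $ i))"
      using exists_smaller_digit[OF w(1) z(1) w(2)] by blast
    then show "\<exists>l<s. Phi w \<bullet> lam l = 0"
    proof cases
      case 1
      then obtain l where "l < s" "lam l = sum_functional M z (zdeg M w)" using lam(2) by blast
      then show ?thesis using sum_functional(2)[OF w(1), where z = z and j = "zdeg M w"] by auto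
    next
      case 2
      then have "coord_functional M z (i, nat (to_int_mod_ring (w $ i))) \<in> ?L" by auto
      then obtain l where "l < s" "lam l = coord_functional M z (i, nat (to_int_mod_ring (w $ i)))"
        using lam(2) by blast
      then show ?thesis
        using coord_functional(2)[OF 2(1) w(1), where z = z and j = "nat (to_int_mod_ring (w $ i))"]
        by (auto simp: of_nat_to_int_mod_ring)
    qed
  qed (use lam(1) in auto)
qed

section \<open>Upper bounds for the averages over \<open>Phi\<close>\<close>

lemma Phi_form_system:
  assumes "2 \<le> k"
  shows "form_system (M + 1) (k - 1) (S_set k M) (Phi :: 'p::prime_card fp_vec \<Rightarrow> 'p fp_vec)"
  by unfold_locales (use assms in \<open>auto simp: finite_S_set S_set_def intro: Phi_carrier\<close>)

text \<open>With \<open>J\<close> the \<open>k - 1 - zdeg M z\<close> digit sums above that of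
  \<open>z\<close>, exactly \<open>k - 1\<close> functionals separate \<open>z\<close> from all
  other forms at once.\<close>

lemma Lambda_Phi_le_of_small_degree:
  fixes f :: "'p::prime_card fp_vec \<Rightarrow> 'p fp_vec \<Rightarrow> complex"
  assumes k: "2 \<le> k" "k \<le> CARD('p)" and z: "z \<in> S_set k M"
    and f: "\<And>w. w \<in> S_set k M \<Longrightarrow> one_bounded n (f w)"
  shows "cmod (Lambda_Phi k M n f) \<le> gowers_norm n (k - 1) (f z)"
proof -
  interpret form_system n "M + 1" "k - 1" "S_set k M" "Phi :: 'p fp_vec \<Rightarrow> 'p fp_vec"
    by (rule Phi_form_system[OF k(1)])
  have zc: "z \<in> carrier_vec M" "zdeg M z < k" using z by (auto simp: S_set_eq)
  obtain lam where lam: "\<And>l. lam l \<in> carrier_vec (Suc M)" "\<And>l. Phi z \<bullet> lam l = 1"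
    "\<And>w. w \<in> carrier_vec M \<Longrightarrow> w \<noteq> z \<Longrightarrow> zdeg M w \<le> zdeg M z \<or> zdeg M w \<in> {zdeg M z<..<k} \<or>
       (\<exists>i<M. nat (to_int_mod_ring (w $ i)) < nat (to_int_mod_ring (z $ i))) \<Longrightarrow>
       \<exists>l<k - 1. Phi w \<bullet> lam l = 0"
  proof (rule separated_by_digits[OF zc(1)])
    show "zdeg M z + card {zdeg M z<..<k} \<le> k - 1" using zc(2) by simp
    \<comment> \<open>Here \<open>k \<le> p\<close> enters: the digit sums below \<open>k\<close>
      stay distinct modulo \<open>p\<close>.\<close>
    show "(of_nat j :: 'p mod_ring) \<noteq> of_nat (zdeg M z)" if "j \<in> {zdeg M z<..<k}" for j
      using that k(2) by (subst of_nat_mod_ring_eq_iff) auto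
  qed auto
  have "\<exists>l<k - 1. Phi w \<bullet> lam l = 0" if "w \<in> S_set k M" "w \<noteq> z" for w
    using lam(3)[of w] that by (cases "zdeg M w \<le> zdeg M z") (auto simp: S_set_eq)
  then have "separated z lam {}"
    unfolding separated_def using lam(1,2) by auto
  then show ?thesis
    unfolding Lambda_Phi_def by (rule form_avg_le_gowers_norm[OF z]) (use f in auto)
qed

text \<open>With \<open>J\<close> empty the functionals kill the other forms of digit sum at most
  that of \<open>z\<close>; the heavier ones are left to the induction on weights, started from
  \<open>E = {}\<close>.\<close>

lemma Lambda_Phi_power_le:
  fixes f :: "'p::prime_card fp_vec \<Rightarrow> 'p fp_vec \<Rightarrow> complex"
  assumes k: "2 \<le> k" and z: "z \<in> S_set k M"
    and f: "\<And>w. w \<in> S_set k M \<Longrightarrow> one_bounded n (f w)"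
  shows "cmod (Lambda_Phi k M n f) ^ (2 ^ (card (S_set k M :: 'p fp_vec set) - 1)) \<le> gowers_norm n (k - 1) (f z)"
proof -
  interpret form_system n "M + 1" "k - 1" "S_set k M" "Phi :: 'p fp_vec \<Rightarrow> 'p fp_vec"
    by (rule Phi_form_system[OF k])
  have sep: "\<exists>lam. separated z lam {w. zdeg M z < zdeg M w}" if "z \<in> S_set k M" for z
  proof -
    have zc: "z \<in> carrier_vec M" "zdeg M z < k" using that by (auto simp: S_set_eq)
    obtain lam where "\<And>l. lam l \<in> carrier_vec (Suc M)" "\<And>l. Phi z \<bullet> lam l = 1"
      "\<And>w. w \<in> carrier_vec M \<Longrightarrow> w \<noteq> z \<Longrightarrow> zdeg M w \<le> zdeg M z \<or> zdeg M w \<in> {} \<or>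
       (\<exists>i<M. nat (to_int_mod_ring (w $ i)) < nat (to_int_mod_ring (z $ i))) \<Longrightarrow>
       \<exists>l<k - 1. Phi w \<bullet> lam l = 0"
    proof (rule separated_by_digits[OF zc(1)])
      show "zdeg M z + card ({} :: nat set) \<le> k - 1" using zc(2) by simp
    qed auto
    then have "separated z lam {w. zdeg M z < zdeg M w}"
      unfolding separated_def by (auto simp: S_set_eq)
    then show ?thesis by blast
  qed
  show ?thesis
    unfolding Lambda_Phi_def using form_avg_power_le_gowers_norm[OF sep f, where E = "{}" and i = z] z by simp
qed

section \<open>Phases of monomials\<close>

definition add_char :: "'p::prime_card mod_ring \<Rightarrow> complex" where
  "add_char a = cis (2 * pi * (of_int (to_int_mod_ring a) / real CARD('p)))"

lemma add_char_0 [simp]: "add_char 0 = 1"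
  by (simp add: add_char_def)

lemma cmod_add_char [simp]: "cmod (add_char a) = 1"
  by (simp add: add_char_def)

lemma cis_mod:
  assumes "0 < p"
  shows "cis (2 * pi * (of_int (m mod int p) / real p)) = cis (2 * pi * (of_int m / real p))"
proof -
  have "of_int m = real_of_int (m div int p) * real p + of_int (m mod int p)"
    by (metis div_mult_mod_eq of_int_add of_int_mult of_int_of_nat_eq)
  then have "2 * pi * (of_int m / real p) =
      2 * pi * of_int (m div int p) + 2 * pi * (of_int (m mod int p) / real p)"
    using assms by (simp add: field_simps)
  then show ?thesis by (simp flip: cis_mult)
qed

lemma add_char_add: "add_char (a + b) = add_char a * add_char b"
  unfolding add_char_def to_int_mod_ring_add
  by (subst cis_mod) (simp_all add: cis_mult distrib_left add_divide_distrib)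

lemma add_char_sum: "add_char (\<Sum>x\<in>A. f x) = (\<Prod>x\<in>A. add_char (f x))"
  by (induction A rule: infinite_finite_induct) (auto simp: add_char_add)

lemma add_char_diff: "add_char (a - b) = add_char a * cnj (add_char b)"
proof -
  have "add_char a * cnj (add_char b) = add_char (a - b) * (add_char b * cnj (add_char b))"
    using add_char_add[of "a - b" b] by simp
  also have "add_char b * cnj (add_char b) = 1"
    using complex_norm_square[of "add_char b"] by simp
  finally show ?thesis by simp
qed

lemma add_char_eq_1D:
  fixes a :: "'p::prime_card mod_ring"
  assumes "add_char a = 1"
  shows "a = 0"
proof -
  have "cos (2 * pi * (of_int (to_int_mod_ring a) / real CARD('p))) = 1"
    using assms by (simp add: add_char_def complex_eq_iff)
  then obtain q :: int where "2 * pi * (of_int (to_int_mod_ring a) / real CARD('p)) = of_int q * 2 * pi"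
    by (auto simp: cos_one_2pi_int)
  then have "of_int (to_int_mod_ring a) = real_of_int q * real CARD('p)"
    by (simp add: field_simps)
  then have q: "to_int_mod_ring a = q * int CARD('p)"
    by (metis of_int_eq_iff of_int_mult of_int_of_nat_eq)
  then have "int CARD('p) dvd to_int_mod_ring a" by simp
  then have "to_int_mod_ring a = 0"
    using to_int_mod_ring_bounds[of a] by (metis order_le_less zdvd_not_zless)
  then show ?thesis by (metis of_nat_to_int_mod_ring of_nat_0 nat_0_iff order_refl)
qed

text \<open>The real parts are at most 1 and average to 1, so each equals 1; the bound on the
  modulus then leaves no imaginary part.\<close>

lemma avg_eq_1D:
  assumes A: "finite A" "\<And>x. x \<in> A \<Longrightarrow> cmod (f x) \<le> 1" and avg: "avg A f = 1" and x: "x \<in> A"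
  shows "f x = 1"
proof -
  have "(\<Sum>x\<in>A. f x) = of_nat (card A)"
    using avg A(1) x by (auto simp: avg_def divide_eq_eq split: if_splits)
  then have "(\<Sum>x\<in>A. 1 - Re (f x)) = 0"
    by (simp add: sum_subtractf flip: Re_sum)
  moreover have "0 \<le> 1 - Re (f x)" if "x \<in> A" for x
    using A(2)[OF that] complex_Re_le_cmod[of "f x"] by linarith
  ultimately have re: "Re (f x) = 1"
    using x A(1) by (simp add: sum_nonneg_eq_0_iff)
  have "(cmod (f x))\<^sup>2 \<le> 1" using A(2)[OF x] by (simp add: power_le_one)
  then have "Im (f x) = 0" using re by (simp add: cmod_power2)
  with re show ?thesis by (simp add: complex_eq_iff)
qed

lemma one_bounded_mderiv:
  assumes "one_bounded n f" "a \<in> carrier_vec n"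
  shows "one_bounded n (mderiv a f)"
  using assms by (auto simp: one_bounded_def mderiv_def norm_mult intro!: mult_le_one)

lemma cmod_gpow_le_1: "one_bounded n f \<Longrightarrow> cmod (gpow n s f) \<le> 1"
proof (induction s arbitrary: f)
  case 0
  then show ?case by (auto simp: one_bounded_def intro: cmod_avg_le)
next
  case (Suc s)
  then show ?case by (auto intro!: cmod_avg_le Suc.IH one_bounded_mderiv)
qed

text \<open>Differentiating in the direction of the \<open>r\<close>-th unit vector removes the variable \<open>x\<^sub>r\<close>.\<close>

lemma gpow_monomial_neq_1:
  fixes c :: "'p::prime_card mod_ring"
  assumes "r + s \<le> d" "c \<noteq> 0"
  shows "gpow d s (\<lambda>x. add_char (c * (\<Prod>i\<in>{r..<d}. x $ i))) \<noteq> 1"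
  using assms
proof (induction s arbitrary: r c)
  case 0
  show ?case
  proof
    assume "gpow d 0 (\<lambda>x. add_char (c * (\<Prod>i\<in>{r..<d}. x $ i))) = 1"
    then have "add_char (c * (\<Prod>i\<in>{r..<d}. vec d (\<lambda>_. 1) $ i)) = 1"
      unfolding gpow.simps by (rule avg_eq_1D[rotated 2]) auto
    then show False using add_char_eq_1D 0 by auto
  qed
next
  case (Suc s)
  define f where "f x = add_char (c * (\<Prod>i\<in>{r..<d}. x $ i))" for x :: "'p fp_vec"
  have f: "one_bounded d f" by (simp add: one_bounded_def f_def)
  have r: "{r..<d} = insert r {Suc r..<d}" using Suc.prems by auto
  \<comment> \<open>With \<open>Q\<close> the product of the later variables,
    \<open>c x_r Q - c (x_r + 1) Q = - c Q\<close>.\<close>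
  have d: "mderiv (unit_vec d r) f x = add_char (- c * (\<Prod>i\<in>{Suc r..<d}. x $ i))"
    if x: "x \<in> carrier_vec d" for x
  proof -
    have "(\<Prod>i\<in>{Suc r..<d}. (x + unit_vec d r) $ i) = (\<Prod>i\<in>{Suc r..<d}. x $ i)"
      using x by (intro prod.cong) auto
    moreover have "(x + unit_vec d r) $ r = x $ r + 1" using x Suc.prems by simp
    ultimately show ?thesis
      unfolding mderiv_def f_def add_char_diff[symmetric] r by (simp add: algebra_simps)
  qed
  show ?case
  proof
    assume "gpow d (Suc s) (\<lambda>x. add_char (c * (\<Prod>i\<in>{r..<d}. x $ i))) = 1"
    then have "avg (carrier_vec d) (\<lambda>a. gpow d s (mderiv a f)) = 1"
      unfolding f_def by simp
    then have "gpow d s (mderiv (unit_vec d r) f) = 1"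
      by (rule avg_eq_1D[rotated 2]) (auto intro!: cmod_gpow_le_1 one_bounded_mderiv f)
    moreover have "gpow d s (mderiv (unit_vec d r) f) =
        gpow d s (\<lambda>x. add_char (- c * (\<Prod>i\<in>{Suc r..<d}. x $ i)))"
      by (rule gpow_cong) (rule d)
    ultimately have "gpow d s (\<lambda>x. add_char (- c * (\<Prod>i\<in>{Suc r..<d}. x $ i))) = 1"
      by simp
    then show False using Suc.IH[of "Suc r" "- c"] Suc.prems by simp
  qed
qed

section \<open>Tensor powers of phases\<close>

lemma vec_first_append [simp]: "v \<in> carrier_vec d \<Longrightarrow> vec_first (v @\<^sub>v w) d = v"
  by (intro eq_vecI) (auto simp: vec_first_def)

lemma vec_last_append [simp]: "w \<in> carrier_vec m \<Longrightarrow> vec_last (v @\<^sub>v w) m = w"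
  by (intro eq_vecI) (auto simp: vec_last_def)

lemma avg_carrier_append:
  "avg (carrier_vec (d + m)) F = avg (carrier_vec d) (\<lambda>a. avg (carrier_vec m) (\<lambda>b. F (a @\<^sub>v b)))"
proof -
  have "bij_betw (\<lambda>(a, b). a @\<^sub>v b) (carrier_vec d \<times> carrier_vec m) (carrier_vec (d + m) :: 'a vec set)"
    by (rule bij_betwI[where g = "\<lambda>x. (vec_first x d, vec_last x m)"]) auto
  from avg_bij[OF this, of F, symmetric] show ?thesis by (simp add: avg_Times)
qed

definition tensor :: "nat \<Rightarrow> nat \<Rightarrow> ('p::prime_card fp_vec \<Rightarrow> complex) \<Rightarrow> ('p fp_vec \<Rightarrow> complex) \<Rightarrow> 'p fp_vec \<Rightarrow> complex" where
  "tensor d m g h x = g (vec_first x d) * h (vec_last x m)"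

text \<open>A derivative in a concatenated direction acts on the two tensor factors separately, so
  every average factors.\<close>

lemma gpow_tensor:
  fixes g h :: "'p::prime_card fp_vec \<Rightarrow> complex"
  shows "gpow (d + m) s (tensor d m g h) = gpow d s g * gpow m s h"
proof (induction s arbitrary: g h)
  case 0
  show ?case
    by (simp add: avg_carrier_append tensor_def avg_mult_left avg_mult_right)
next
  case (Suc s)
  have der: "mderiv (a @\<^sub>v b) (tensor d m g h) x = tensor d m (mderiv a g) (mderiv b h) x"
    if "a \<in> carrier_vec d" "b \<in> carrier_vec m" "x \<in> carrier_vec (d + m)" for a b x :: "'p fp_vec"
  proof -
    have "vec_first (x + (a @\<^sub>v b)) d = vec_first x d + a" "vec_last (x + (a @\<^sub>v b)) m = vec_last x m + b"
      using that by (auto simp: vec_first_def vec_last_def intro!: eq_vecI)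
    then show ?thesis by (simp add: mderiv_def tensor_def mult_ac)
  qed
  have "gpow (d + m) (Suc s) (tensor d m g h) =
      avg (carrier_vec d) (\<lambda>a. avg (carrier_vec m) (\<lambda>b. gpow (d + m) s (mderiv (a @\<^sub>v b) (tensor d m g h))))"
    by (simp add: avg_carrier_append)
  also have "\<dots> = avg (carrier_vec d) (\<lambda>a. avg (carrier_vec m) (\<lambda>b. gpow d s (mderiv a g) * gpow m s (mderiv b h)))"
    unfolding Suc.IH[symmetric] by (intro avg_cong refl gpow_cong der)
  finally show ?case by (simp add: avg_mult_left avg_mult_right)
qed

lemma gpow_1 [simp]: "gpow n s (\<lambda>_. 1) = 1"
proof (induction s)
  case (Suc s)
  have "mderiv a (\<lambda>_. 1) = (\<lambda>_. 1)" for a :: "'a fp_vec" by (simp add: mderiv_def fun_eq_iff)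
  then show ?case using Suc by simp
qed simp

text \<open>Living in dimension \<open>N * d\<close>, it raises \<open>gpow\<close> to the power
  \<open>N\<close>, so a value in \<open>[0, 1)\<close> becomes arbitrarily small.\<close>

primrec tensor_power :: "nat \<Rightarrow> ('p::prime_card fp_vec \<Rightarrow> complex) \<Rightarrow> nat \<Rightarrow> 'p fp_vec \<Rightarrow> complex" where
  "tensor_power d g 0 = (\<lambda>_. 1)"
| "tensor_power d g (Suc N) = tensor d (N * d) g (tensor_power d g N)"

lemma gpow_tensor_power: "gpow (N * d) s (tensor_power d g N) = gpow d s g ^ N"
  by (induction N) (simp_all add: gpow_tensor)

lemma cmod_tensor_power:
  fixes g :: "'p::prime_card fp_vec \<Rightarrow> complex"
  assumes "\<And>x. cmod (g x) = 1"
  shows "cmod (tensor_power d g N x) = 1"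
  by (induction N arbitrary: x) (simp_all add: tensor_def norm_mult assms)

text \<open>Linear forms act coordinate by coordinate, so the variables split into their first
  \<open>d\<close> and last \<open>N * d\<close> entries, and the identity is inherited from the two
  pieces.\<close>

lemma prod_tensor_power_lin_form:
  fixes g :: "'i \<Rightarrow> 'p::prime_card fp_vec \<Rightarrow> complex"
  assumes "\<And>v. v \<in> tuples d e \<Longrightarrow> (\<Prod>z\<in>I. g z (lin_form d (\<psi> z) v)) = 1"
    and psi: "\<And>z. z \<in> I \<Longrightarrow> \<psi> z \<in> carrier_vec e"
    and "v \<in> tuples (N * d) e"
  shows "(\<Prod>z\<in>I. tensor_power d (g z) N (lin_form (N * d) (\<psi> z) v)) = 1"
  using assms(3)
proof (induction N arbitrary: v)
  case (Suc N)
  let ?v = "\<lambda>i\<in>{..<e}. vec_first (v i) d" and ?w = "\<lambda>i\<in>{..<e}. vec_last (v i) (N * d)"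
  have "(\<Prod>z\<in>I. tensor_power d (g z) (Suc N) (lin_form (Suc N * d) (\<psi> z) v)) =
      (\<Prod>z\<in>I. g z (lin_form d (\<psi> z) ?v) * tensor_power d (g z) N (lin_form (N * d) (\<psi> z) ?w))"
  proof (rule prod.cong[OF refl])
    fix z assume z: "z \<in> I"
    have "vec_first (lin_form (Suc N * d) (\<psi> z) v) d = lin_form d (\<psi> z) ?v"
      using psi[OF z] by (intro eq_vecI) (auto simp: lin_form_def vec_first_def)
    moreover have "vec_last (lin_form (Suc N * d) (\<psi> z) v) (N * d) = lin_form (N * d) (\<psi> z) ?w"
      using psi[OF z] tuplesD_dim[OF Suc.prems]
      by (intro eq_vecI) (auto simp: lin_form_def vec_last_def intro!: sum.cong)
    ultimately show "tensor_power d (g z) (Suc N) (lin_form (Suc N * d) (\<psi> z) v) =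
        g z (lin_form d (\<psi> z) ?v) * tensor_power d (g z) N (lin_form (N * d) (\<psi> z) ?w)"
      by (simp add: tensor_def)
  qed
  also have "\<dots> = (\<Prod>z\<in>I. g z (lin_form d (\<psi> z) ?v)) *
      (\<Prod>z\<in>I. tensor_power d (g z) N (lin_form (N * d) (\<psi> z) ?w))"
    by (rule prod.distrib)
  also have "\<dots> = 1"
    by (subst assms(1), blast intro: tuples_restrict vec_first_carrier,
        subst Suc.IH, blast intro: tuples_restrict vec_last_carrier) simp
  finally show ?case .
qed simp

section \<open>Alternating sums over subsets\<close>

lemma sum_Pow_insert:
  assumes "finite J" "j \<notin> J"
  shows "(\<Sum>T\<in>Pow (insert j J). g T) = (\<Sum>T\<in>Pow J. g T) + (\<Sum>T\<in>Pow J. g (insert j T))"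
proof -
  have "(\<Sum>T\<in>Pow (insert j J). g T) = (\<Sum>T\<in>Pow J. g T) + (\<Sum>T\<in>insert j ` Pow J. g T)"
    unfolding Pow_insert by (rule sum.union_disjoint) (use assms in auto)
  also have "(\<Sum>T\<in>insert j ` Pow J. g T) = (\<Sum>T\<in>Pow J. g (insert j T))"
    using assms by (subst sum.reindex) (auto simp: inj_on_def)
  finally show ?thesis .
qed

text \<open>A polynomial of degree \<open>card I\<close> dies under more than \<open>card I\<close>
  differences. Split off the factor of \<open>a\<close>: its term \<open>x a\<close> leaves a
  shorter product, and its term \<open>t j a\<close> selects the subsets containing
  \<open>j\<close>, where one direction and one factor are lost together.\<close>

lemma alternating_sum_prod_eq_0:
  fixes t :: "'j \<Rightarrow> 'i \<Rightarrow> 'a::comm_ring_1"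
  assumes "finite I" "finite J" "card I < card J"
  shows "(\<Sum>T\<in>Pow J. (-1) ^ card T * (\<Prod>i\<in>I. x i + (\<Sum>j\<in>T. t j i))) = 0"
  using assms
proof (induction I arbitrary: J x rule: finite_induct)
  case empty
  then obtain j where j: "j \<in> J" by fastforce
  define K where "K = J - {j}"
  have K: "J = insert j K" "finite K" "j \<notin> K" using j empty unfolding K_def by auto
  have "(-1::'a) ^ card (insert j T) = - ((-1) ^ card T)" if "T \<in> Pow K" for T
    using that K by (subst card_insert_disjoint) (auto intro: finite_subset)
  then show ?case unfolding K(1) sum_Pow_insert[OF K(2,3)] by (simp add: sum_negf)
next
  case (insert a I)
  define R where "R T = (-1) ^ card T * (\<Prod>i\<in>I. x i + (\<Sum>j\<in>T. t j i))" for T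
  have fin: "finite T" if "T \<in> Pow J" for T
    using that insert.prems(1) finite_subset by auto
  have "(\<Sum>T\<in>Pow J. (-1) ^ card T * (\<Prod>i\<in>insert a I. x i + (\<Sum>j\<in>T. t j i))) =
      (\<Sum>T\<in>Pow J. x a * R T + (\<Sum>j\<in>J. if j \<in> T then t j a * R T else 0))"
  proof (rule sum.cong[OF refl])
    fix T assume T: "T \<in> Pow J"
    have "(\<Sum>j\<in>T. t j a * R T) = (\<Sum>j\<in>J. if j \<in> T then t j a * R T else 0)"
      using T insert.prems(1) by (simp add: sum.If_cases Int_absorb1)
    then show "(-1) ^ card T * (\<Prod>i\<in>insert a I. x i + (\<Sum>j\<in>T. t j i)) =
        x a * R T + (\<Sum>j\<in>J. if j \<in> T then t j a * R T else 0)"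
      using insert.hyps by (simp add: R_def sum_distrib_right[symmetric] algebra_simps)
  qed
  also have "\<dots> = x a * (\<Sum>T\<in>Pow J. R T) + (\<Sum>j\<in>J. \<Sum>T\<in>Pow J. if j \<in> T then t j a * R T else 0)"
    by (subst sum.swap) (simp add: sum.distrib sum_distrib_left)
  also have "(\<Sum>T\<in>Pow J. R T) = 0"
    unfolding R_def using insert by (intro insert.IH) auto
  also have "(\<Sum>j\<in>J. \<Sum>T\<in>Pow J. if j \<in> T then t j a * R T else 0) = 0"
  proof (rule sum.neutral, rule ballI)
    fix j assume j: "j \<in> J"
    define K where "K = J - {j}"
    have K: "J = insert j K" "finite K" "j \<notin> K" using j insert.prems unfolding K_def by auto
    \<comment> \<open>Fixing \<open>j\<close> as a member of the subset moves the base point by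
      \<open>t j\<close> and flips the sign.\<close>
    have R: "R (insert j T) = - ((-1) ^ card T * (\<Prod>i\<in>I. (x i + t j i) + (\<Sum>j\<in>T. t j i)))"
      if "T \<in> Pow K" for T
    proof -
      have "finite T" "j \<notin> T" using that K by (auto intro: finite_subset)
      then show ?thesis by (simp add: R_def add.assoc)
    qed
    have "(\<Sum>T\<in>Pow J. if j \<in> T then t j a * R T else 0) = (\<Sum>T\<in>Pow K. t j a * R (insert j T))"
      unfolding K(1) sum_Pow_insert[OF K(2,3)] using K(3) by (auto intro!: sum.neutral)
    also have "\<dots> = (\<Sum>T\<in>Pow K. - t j a * ((-1) ^ card T * (\<Prod>i\<in>I. (x i + t j i) + (\<Sum>j\<in>T. t j i))))"
      by (intro sum.cong refl) (simp add: R)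
    also have "\<dots> = - t j a * (\<Sum>T\<in>Pow K. (-1) ^ card T * (\<Prod>i\<in>I. (x i + t j i) + (\<Sum>j\<in>T. t j i)))"
      by (rule sum_distrib_left[symmetric])
    also have "(\<Sum>T\<in>Pow K. (-1) ^ card T * (\<Prod>i\<in>I. (x i + t j i) + (\<Sum>j\<in>T. t j i))) = 0"
      using insert K by (intro insert.IH) auto
    finally show "(\<Sum>T\<in>Pow J. if j \<in> T then t j a * R T else 0) = 0" by simp
  qed
  finally show ?case by simp
qed

section \<open>The true complexity of \<open>\<Phi>\<close>\<close>

text \<open>The set \<open>{..<k - 1}\<close> is cut into \<open>M\<close> blocks of at most \<open>p - 1\<close> elements;
  \<open>block_count M T\<close> counts the elements of \<open>T\<close> in each block.\<close>

definition block_count :: "nat \<Rightarrow> nat set \<Rightarrow> 'p::prime_card fp_vec" where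
  "block_count M T = vec M (\<lambda>i. of_nat (card {j\<in>T. j div (CARD('p) - 1) = i}))"

lemma block_count_carrier [simp]: "block_count M T \<in> carrier_vec M"
  by (simp add: block_count_def)

text \<open>A block has \<open>p - 1\<close> elements, so its count is below \<open>p\<close> and no
  reduction modulo \<open>p\<close> occurs; the counts add up to \<open>card T\<close>.\<close>

lemma zdeg_block_count:
  assumes T: "T \<subseteq> {..<M * (CARD('p::prime_card) - 1)}"
  shows "zdeg M (block_count M T :: 'p fp_vec) = card T"
proof -
  let ?q = "CARD('p) - 1"
  have q: "0 < ?q" using nontriv[where 'a = 'p] by simp
  have fin: "finite T" using T finite_subset by blast
  have "card {j\<in>T. j div ?q = i} < CARD('p)" for i
  proof -
    have "{j\<in>T. j div ?q = i} \<subseteq> {i * ?q..<i * ?q + ?q}"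
    proof
      fix j assume "j \<in> {j\<in>T. j div ?q = i}"
      then have "j = i * ?q + j mod ?q" by (metis (mono_tags) div_mult_mod_eq mem_Collect_eq)
      moreover have "j mod ?q < ?q" using q by simp
      ultimately show "j \<in> {i * ?q..<i * ?q + ?q}" by (metis atLeastLessThan_iff le_add1 nat_add_left_cancel_less)
    qed
    then have "card {j\<in>T. j div ?q = i} \<le> card {i * ?q..<i * ?q + ?q}" by (intro card_mono) auto
    then show ?thesis using q by simp
  qed
  then have "zdeg M (block_count M T :: 'p fp_vec) = (\<Sum>i<M. card {j\<in>T. j div ?q = i})"
    by (simp add: zdeg_def block_count_def to_int_mod_ring_of_nat)
  also have "\<dots> = (\<Sum>i<M. \<Sum>j\<in>{j\<in>T. j div ?q = i}. 1)" by simp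
  also have "\<dots> = (\<Sum>j\<in>T. 1)"
    by (rule sum.group) (use fin T q in \<open>auto simp: less_mult_imp_div_less\<close>)
  finally show ?thesis by simp
qed

text \<open>The form of \<open>block_count M T\<close> evaluates the cube vertex \<open>T\<close>
  whose direction \<open>j\<close> is the variable attached to the block of \<open>j\<close>.
  Directions repeat inside a block, which is how a cube with more than \<open>M\<close> directions
  fits into \<open>M\<close> variables.\<close>

lemma lin_form_block_count:
  fixes v :: "nat \<Rightarrow> 'p::prime_card fp_vec"
  assumes T: "T \<subseteq> {..<M * (CARD('p) - 1)}" and v: "v 0 \<in> carrier_vec n" and l: "l < n"
  shows "lin_form n (Phi (block_count M T)) v $ l = v 0 $ l + (\<Sum>j\<in>T. v (Suc (j div (CARD('p) - 1))) $ l)"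
proof -
  let ?q = "CARD('p) - 1"
  have q: "0 < ?q" using nontriv[where 'a = 'p] by simp
  have fin: "finite T" using T finite_subset by blast
  have "(\<Sum>i<M. block_count M T $ i * v (Suc i) $ l) =
      (\<Sum>i<M. \<Sum>j\<in>{j\<in>T. j div ?q = i}. v (Suc (j div ?q)) $ l)"
    by (intro sum.cong refl) (simp add: block_count_def)
  also have "\<dots> = (\<Sum>j\<in>T. v (Suc (j div ?q)) $ l)"
    by (rule sum.group) (use fin T q in \<open>auto simp: less_mult_imp_div_less\<close>)
  finally show ?thesis
    using lin_form_Phi[of "block_count M T" M v n] v l by simp
qed

text \<open>This is the coefficient \<open>c\<^sub>z\<close> of the lower bound: all
  \<open>T\<close> with the same block counts give the same form, so their signs are
  collected.\<close>

definition sign_sum :: "nat \<Rightarrow> nat \<Rightarrow> 'p::prime_card fp_vec \<Rightarrow> 'p mod_ring" where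
  "sign_sum k M z = (\<Sum>T\<in>{T\<in>Pow {..<k - 1}. block_count M T = z}. (-1) ^ card T)"

text \<open>Only the empty set has vanishing block counts, because these sum to
  \<open>card T\<close>. This provides a nontrivial phase for the lower bound.\<close>

lemma sign_sum_0:
  assumes "k \<le> M * (CARD('p::prime_card) - 1) + 1"
  shows "sign_sum k M (0\<^sub>v M :: 'p fp_vec) = 1"
proof -
  have "{T\<in>Pow {..<k - 1}. block_count M T = (0\<^sub>v M :: 'p fp_vec)} = {{}}"
  proof (intro equalityI subsetI)
    fix T assume "T \<in> {T\<in>Pow {..<k - 1}. block_count M T = (0\<^sub>v M :: 'p fp_vec)}"
    then have T: "T \<subseteq> {..<k - 1}" "block_count M T = (0\<^sub>v M :: 'p fp_vec)" by auto
    have "T \<subseteq> {..<M * (CARD('p) - 1)}" using T(1) assms by auto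
    then have "card T = 0" using zdeg_block_count[of T M, where 'p = 'p] T(2) by (simp add: zdeg_def)
    moreover have "finite T" using T(1) finite_subset by blast
    ultimately show "T \<in> {{}}" by simp
  qed (auto simp: block_count_def intro!: eq_vecI)
  then show ?thesis by (simp add: sign_sum_def)
qed

definition phase :: "nat \<Rightarrow> nat \<Rightarrow> 'p::prime_card fp_vec \<Rightarrow> 'p fp_vec \<Rightarrow> complex" where
  "phase k M z x = add_char (sign_sum k M z * (\<Prod>i\<in>{0..<k - 2}. x $ i))"

text \<open>Grouping by block counts rewrites the exponent as an alternating sum over the subsets of
  \<open>{..<k - 1}\<close>; a product of \<open>k - 2\<close> coordinates has too small a degree to
  survive \<open>k - 1\<close> differences.\<close>

lemma prod_phase:
  fixes v :: "nat \<Rightarrow> 'p::prime_card fp_vec"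
  assumes k: "2 \<le> k" "k \<le> M * (CARD('p) - 1) + 1" and v: "v \<in> tuples (k - 2) (M + 1)"
  shows "(\<Prod>z\<in>S_set k M. phase k M z (lin_form (k - 2) (Phi z) v)) = 1"
proof -
  let ?P = "\<lambda>z. \<Prod>i\<in>{0..<k - 2}. lin_form (k - 2) (Phi z) v $ i"
  let ?J = "{..<k - 1}"
  have J: "T \<subseteq> {..<M * (CARD('p) - 1)}" if "T \<in> Pow ?J" for T
    using that k(2) by auto
  have "(\<Sum>z\<in>S_set k M. sign_sum k M z * ?P z) =
      (\<Sum>z\<in>(S_set k M :: 'p fp_vec set). \<Sum>T\<in>{T\<in>Pow ?J. block_count M T = z}. (-1) ^ card T * ?P (block_count M T))"
    unfolding sign_sum_def sum_distrib_right by (intro sum.cong refl) auto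
  also have "\<dots> = (\<Sum>T\<in>Pow ?J. (-1) ^ card T * ?P (block_count M T))"
  proof (rule sum.group)
    show "block_count M ` Pow ?J \<subseteq> (S_set k M :: 'p fp_vec set)"
    proof
      fix z :: "'p fp_vec" assume "z \<in> block_count M ` Pow ?J"
      then obtain T where T: "T \<in> Pow ?J" "z = block_count M T" by auto
      have "card T \<le> card ?J" using T(1) by (intro card_mono) auto
      then show "z \<in> S_set k M"
        using k(1) zdeg_block_count[OF J[OF T(1)]] unfolding S_set_eq T(2) by simp
    qed
  qed (auto simp: finite_S_set)
  also have "\<dots> = (\<Sum>T\<in>Pow ?J. (-1) ^ card T *
      (\<Prod>i\<in>{0..<k - 2}. v 0 $ i + (\<Sum>j\<in>T. v (Suc (j div (CARD('p) - 1))) $ i)))"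
    using v by (intro sum.cong refl arg_cong2[where f = "(*)"] prod.cong lin_form_block_count J) auto
  also have "\<dots> = 0"
    by (rule alternating_sum_prod_eq_0) (use k(1) in auto)
  finally show ?thesis
    unfolding phase_def add_char_sum[symmetric] by simp
qed

lemma not_true_complexity_below:
  assumes k: "2 \<le> k" "k \<le> M * (CARD('p::prime_card) - 1) + 1" and s: "s < k - 2"
  shows "\<not> true_complexity_at_most (M + 1) (S_set k M :: 'p fp_vec set) Phi s"
proof
  assume "true_complexity_at_most (M + 1) (S_set k M :: 'p fp_vec set) Phi s"
  then obtain \<epsilon> :: "real \<Rightarrow> real" where e0: "\<epsilon> 0 = 0" and lim: "(\<epsilon> \<longlongrightarrow> 0) (at_right 0)"
    and bound: "\<And>n f. \<forall>z\<in>S_set k M. one_bounded n (f z) \<Longrightarrow>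
      \<forall>z\<in>S_set k M. cmod (form_avg n (M + 1) (S_set k M :: 'p fp_vec set) Phi f) \<le> \<epsilon> (gowers_norm n (s + 1) (f z))"
    unfolding true_complexity_at_most_def by blast
  let ?d = "k - 2"
  define f where "f N z = tensor_power ?d (phase k M z) N" for N and z :: "'p fp_vec"
  define r where "r N = gowers_norm (N * ?d) (s + 1) (f N (0\<^sub>v M))" for N
  have f1: "cmod (f N z x) = 1" for N z x
    unfolding f_def by (rule cmod_tensor_power) (simp add: phase_def)
  have avg1: "form_avg (N * ?d) (M + 1) (S_set k M) Phi (f N) = 1" for N
  proof -
    have "(\<Prod>z\<in>S_set k M. f N z (lin_form (N * ?d) (Phi z) v)) = 1"
      if v: "v \<in> tuples (N * ?d) (M + 1)" for v :: "nat \<Rightarrow> 'p fp_vec"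
      unfolding f_def
    proof (rule prod_tensor_power_lin_form[OF _ _ v])
      show "(\<Prod>z\<in>S_set k M. phase k M z (lin_form (k - 2) (Phi z) v)) = 1"
        if "v \<in> tuples (k - 2) (M + 1)" for v :: "nat \<Rightarrow> 'p fp_vec"
        by (rule prod_phase[OF k that])
    qed (auto simp: S_set_eq Phi_carrier)
    then show ?thesis unfolding form_avg_def by simp
  qed
  have "0\<^sub>v M \<in> (S_set k M :: 'p fp_vec set)" using k(1) by (simp add: S_set_def)
  \<comment> \<open>The average is 1 in every dimension, so the gauge stays at least 1 along the
    norms \<open>r N\<close>, which turn out to tend to 0.\<close>
  then have ge1: "1 \<le> \<epsilon> (r N)" for N
    using bound[of "N * ?d" "f N"] f1 unfolding r_def avg1 by (simp add: one_bounded_def)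
  define w where "w = gpow ?d (s + 1) (phase k M (0\<^sub>v M :: 'p fp_vec))"
  have w: "w = complex_of_real (Re w)"
    unfolding w_def using Im_gpow_Suc by (simp add: complex_eq_iff del: gpow.simps)
  have "0 \<le> Re w" unfolding w_def by (rule gpow_nonneg) simp
  moreover have "cmod w \<le> 1"
    unfolding w_def by (rule cmod_gpow_le_1) (simp add: one_bounded_def phase_def)
  \<comment> \<open>From \<open>s < k - 2\<close> the \<open>s + 1\<close> derivatives do not exceed
    the degree \<open>k - 2\<close> of the monomial.\<close>
  moreover have "w \<noteq> 1"
    unfolding w_def phase_def sign_sum_0[OF k(2)] by (rule gpow_monomial_neq_1) (use s in auto)
  ultimately have Re_w: "0 \<le> Re w" "Re w < 1"
    using w complex_Re_le_cmod[of w] by (auto simp: order.strict_iff_order)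
  have r: "r N = root (2 ^ (s + 1)) (Re w ^ N)" for N
  proof -
    have "gpow (N * ?d) (s + 1) (f N (0\<^sub>v M)) = complex_of_real (Re w ^ N)"
      unfolding f_def gpow_tensor_power w_def[symmetric] by (subst w) simp
    then show ?thesis unfolding r_def gowers_norm_eq_gpow by (simp only: Re_complex_of_real)
  qed
  have r0: "0 \<le> r N" for N unfolding r_def by (rule gowers_norm_nonneg) simp
  \<comment> \<open>The limit along \<open>at_right 0\<close> needs positive norms; a zero norm
    would contradict \<open>\<epsilon> 0 = 0\<close>.\<close>
  have pos: "0 < r N" for N
    using ge1[of N] r0[of N] e0 by (cases "r N = 0") auto
  have "(\<lambda>N. root (2 ^ (s + 1)) (Re w ^ N)) \<longlonglongrightarrow> root (2 ^ (s + 1)) 0"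
    using Re_w by (intro tendsto_real_root LIMSEQ_power_zero) auto
  then have "r \<longlonglongrightarrow> 0" unfolding r by simp
  then have "filterlim r (at_right 0) sequentially"
    using pos by (intro tendsto_imp_filterlim_at_right) auto
  then have "(\<lambda>N. \<epsilon> (r N)) \<longlonglongrightarrow> 0" by (rule filterlim_compose[OF lim])
  then have "(1::real) \<le> 0" by (rule LIMSEQ_le_const) (use ge1 in blast)
  then show False by simp
qed

lemma true_complexity_at_most_powr:
  assumes "0 < c"
    and "\<And>n f i. (\<And>i. i \<in> I \<Longrightarrow> one_bounded n (f i)) \<Longrightarrow> i \<in> I \<Longrightarrow>
      cmod (form_avg n d I \<psi> f) \<le> gowers_norm n (s + 1) (f i) powr c"
  shows "true_complexity_at_most d I \<psi> s"
  unfolding true_complexity_at_most_def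
proof (intro exI[of _ "\<lambda>\<delta>. \<delta> powr c"] conjI allI impI)
  have "((\<lambda>\<delta>. \<delta> powr c) \<longlongrightarrow> 0 powr c) (at_right (0::real))"
    using assms(1) by (intro tendsto_powr' tendsto_const tendsto_ident_at)
      (auto simp: eventually_at_filter)
  then show "((\<lambda>\<delta>. \<delta> powr c) \<longlongrightarrow> 0) (at_right (0::real))" by simp
qed (use assms in auto)

theorem theorem1p10:
  fixes k M :: nat and S :: "'p::prime_card fp_vec set"
  assumes "2 \<le> k" and "k \<le> M * (CARD('p) - 1) + 1"
    and "S = S_set k M"
  shows "has_true_complexity (M + 1) S Phi (k - 2) \<and>
    (\<exists>c::real. 0 < c \<and> c \<le> 1 \<and>
       (k \<le> CARD('p) \<longrightarrow> c = 1) \<and>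
       (k > CARD('p) \<longrightarrow> c = 2 powr (1 - real (card S))) \<and>
       (\<forall>n (f :: 'p fp_vec \<Rightarrow> 'p fp_vec \<Rightarrow> complex).
          (\<forall>z\<in>S. one_bounded n (f z)) \<longrightarrow>
          cmod (Lambda_Phi k M n f) \<le> (MIN z\<in>S. gowers_norm n (k - 1) (f z) powr c)))"
proof -
  define c :: real where "c = (if k \<le> CARD('p) then 1 else 2 powr (1 - real (card S)))"
  have fin: "finite S" and ne: "0\<^sub>v M \<in> S"
    using assms(1) by (simp_all add: assms(3) finite_S_set) (simp add: S_set_def)
  then have card: "1 \<le> card S" by (metis One_nat_def Suc_leI card_gt_0_iff empty_iff)
  have c: "0 < c" "c \<le> 1"
    using powr_mono[of "1 - real (card S)" 0 2] card by (auto simp: c_def)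
  have bound: "cmod (Lambda_Phi k M n f) \<le> gowers_norm n (k - 1) (f z) powr c"
    if f: "\<And>w. w \<in> S \<Longrightarrow> one_bounded n (f w)" and z: "z \<in> S"
    for n and f :: "'p fp_vec \<Rightarrow> 'p fp_vec \<Rightarrow> complex" and z
  proof -
    have nn: "0 \<le> gowers_norm n (k - 1) (f z)" using assms(1) by (intro gowers_norm_nonneg) simp
    show ?thesis
    proof (cases "k \<le> CARD('p)")
      case True
      then have "cmod (Lambda_Phi k M n f) \<le> gowers_norm n (k - 1) (f z)"
        using assms f z by (intro Lambda_Phi_le_of_small_degree) auto
      then show ?thesis using True nn by (simp add: c_def)
    next
      case False
      let ?a = "cmod (Lambda_Phi k M n f)" and ?m = "2 ^ (card S - 1) :: nat"
      obtain r where r: "card S = Suc r" using card by (cases "card S") auto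
      \<comment> \<open>The constant is the reciprocal of the exponent produced by the induction on
        weights.\<close>
      have c_eq: "c = 1 / real ?m"
        using False by (simp add: c_def r powr_minus powr_realpow divide_inverse)
      have "?a ^ ?m \<le> gowers_norm n (k - 1) (f z)"
        using Lambda_Phi_power_le[OF assms(1), where z = z and f = f and M = M and n = n] f z unfolding assms(3) by blast
      then have "(?a ^ ?m) powr c \<le> gowers_norm n (k - 1) (f z) powr c"
        using c by (intro powr_mono2) auto
      moreover have "(?a ^ ?m) powr c = ?a"
      proof (cases "?a = 0")
        case False
        then have "(?a ^ ?m) powr c = (?a powr real ?m) powr c" by (subst powr_realpow) auto
        then show ?thesis using False by (simp add: powr_powr c_eq)
      qed (simp add: power_0_left)
      ultimately show ?thesis by simp
    qed
  qed
  have "true_complexity_at_most (M + 1) S Phi (k - 2)"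
  proof (rule true_complexity_at_most_powr[OF c(1)])
    \<comment> \<open>Subtraction on naturals is truncated, so \<open>2 \<le> k\<close> is what
      matches \<open>k - 2 + 1\<close> with \<open>k - 1\<close>.\<close>
    have "k - 2 + 1 = k - 1" using assms(1) by simp
    then show "cmod (form_avg n (M + 1) S Phi f) \<le> gowers_norm n (k - 2 + 1) (f z) powr c"
      if "\<And>i. i \<in> S \<Longrightarrow> one_bounded n (f i)" "z \<in> S" for n f z
      using bound[OF that] unfolding Lambda_Phi_def assms(3) by simp
  qed
  moreover have "k - 2 \<le> s" if "true_complexity_at_most (M + 1) S Phi s" for s
    using not_true_complexity_below[OF assms(1,2), of s] that unfolding assms(3) by (meson not_less)
  moreover have "cmod (Lambda_Phi k M n f) \<le> (MIN z\<in>S. gowers_norm n (k - 1) (f z) powr c)"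
    if "\<forall>z\<in>S. one_bounded n (f z)" for n and f :: "'p fp_vec \<Rightarrow> 'p fp_vec \<Rightarrow> complex"
    using bound that fin ne by (intro Min.boundedI) auto
  ultimately show ?thesis
    unfolding has_true_complexity_def using c by (auto simp: c_def intro!: exI[of _ c])
qed

end
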